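(* There exists a function $\delta:(0,\infty)\times\mathbb{N}\to(0,\infty)$ with $\delta(\epsilon,k)\to 0$ as $\epsilon\to 0$ for every $k\in\mathbb{N}$, such that the following holds for all $k,n\in\mathbb{N}$ (with $k,n\ge1$) and all $\epsilon>0$: if $H_1,\dots,H_k\in\mathbb{C}_{n\times n}$ are self-adjoint matrices with $\|H_i\|_{op}\le 1$ for all $i$ and $\|[H_i,H_j]\|_{tr}\le\epsilon$ for all $i,j$, then there exist pairwise commuting self-adjoint matrices $A_1,\dots,A_k\in\mathbb{C}_{n\times n}$ such that $\|H_j-A_j\|_{tr}\le\delta(\epsilon,k)$ and $\|A_j\|_{op}\le 1$ for all $j=1,\dots,k$.
   Context: $\mathbb{C}_{n\times n}$ is the set of complex $n\times n$ matrices, $[X,Y]=XY-YX$, $\|A\|_{tr}=\sqrt{\frac1n\sum_{j,k=1}^n|A_{j,k}|^2}$ is the normalized Hilbert-Schmidt norm, and $\|A\|_{op}=\sup\{\|Ax\|:\|x\|=1\}$ is the operator norm with respect to the standard Hilbert space norm on $\mathbb{C}^n$. The function $\delta$ does not depend on the dimension $n$. *)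

theory Defs
  imports "Jordan_Normal_Form.Schur_Decomposition"
begin

definition mat_commutator :: "complex mat \<Rightarrow> complex mat \<Rightarrow> complex mat" where
  "mat_commutator X Y = X * Y - Y * X"

definition cvec_norm :: "complex vec \<Rightarrow> real" where
  "cvec_norm v = sqrt (\<Sum>i<dim_vec v. (cmod (v $ i))\<^sup>2)"

text \<open>Intended for square matrices of positive dimension.\<close>

definition mat_tr_norm :: "complex mat \<Rightarrow> real" where
  "mat_tr_norm A =
     sqrt (1 / real (dim_row A) *
           (\<Sum>j<dim_row A. \<Sum>k<dim_col A. (cmod (A $$ (j, k)))\<^sup>2))"

text \<open>The supremum is taken in the reals; for \<^term>\<open>dim_col A > 0\<close> the set is nonempty and
  bounded, as shown below.\<close>

definition mat_op_norm :: "complex mat \<Rightarrow> real" where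
  "mat_op_norm A =
     Sup {cvec_norm (A *\<^sub>v x) | x. x \<in> carrier_vec (dim_col A) \<and> cvec_norm x = 1}"

lemma index_mat_adjoint:
  assumes "i < dim_col A" "j < dim_row A"
  shows "mat_adjoint (A :: complex mat) $$ (i, j) = cnj (A $$ (j, i))"
  using assms by (simp add: mat_adjoint_def mat_of_rows_index)

lemma cmod_le_cvec_norm:
  assumes "i < dim_vec v"
  shows "cmod (v $ i) \<le> cvec_norm v"
proof -
  have "(cmod (v $ i))\<^sup>2 \<le> (\<Sum>i<dim_vec v. (cmod (v $ i))\<^sup>2)"
    using assms by (intro member_le_sum) auto
  then show ?thesis
    unfolding cvec_norm_def by (rule real_le_rsqrt)
qed

lemma mat_op_norm_set_bdd_above:
  "bdd_above {cvec_norm (A *\<^sub>v x) | x. x \<in> carrier_vec (dim_col A) \<and> cvec_norm x = 1}"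
proof (rule bdd_aboveI)
  fix r assume "r \<in> {cvec_norm (A *\<^sub>v x) | x. x \<in> carrier_vec (dim_col A) \<and> cvec_norm x = 1}"
  then obtain x where x: "x \<in> carrier_vec (dim_col A)" "cvec_norm x = 1"
    and r: "r = cvec_norm (A *\<^sub>v x)" by blast
  have "cmod ((A *\<^sub>v x) $ i) \<le> (\<Sum>j<dim_col A. cmod (A $$ (i, j)))"
    if i: "i < dim_row A" for i
  proof -
    have "(A *\<^sub>v x) $ i = (\<Sum>j<dim_col A. A $$ (i, j) * x $ j)"
      using i x by (simp add: scalar_prod_def lessThan_atLeast0)
    also have "cmod \<dots> \<le> (\<Sum>j<dim_col A. cmod (A $$ (i, j) * x $ j))"
      by (rule norm_sum)
    also have "\<dots> \<le> (\<Sum>j<dim_col A. cmod (A $$ (i, j)))"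
    proof (rule sum_mono)
      fix j assume "j \<in> {..<dim_col A}"
      then have "cmod (x $ j) \<le> 1"
        using cmod_le_cvec_norm[of j x] x by simp
      then show "cmod (A $$ (i, j) * x $ j) \<le> cmod (A $$ (i, j))"
        by (simp add: norm_mult mult_left_le)
    qed
    finally show ?thesis .
  qed
  then have "(\<Sum>i<dim_row A. (cmod ((A *\<^sub>v x) $ i))\<^sup>2)
      \<le> (\<Sum>i<dim_row A. (\<Sum>j<dim_col A. cmod (A $$ (i, j)))\<^sup>2)"
    by (intro sum_mono power_mono) auto
  then show "r \<le> sqrt (\<Sum>i<dim_row A. (\<Sum>j<dim_col A. cmod (A $$ (i, j)))\<^sup>2)"
    unfolding r cvec_norm_def by simp
qed

lemma mat_op_norm_set_nonempty:
  assumes "dim_col A > 0"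
  shows "{cvec_norm (A *\<^sub>v x) | x. x \<in> carrier_vec (dim_col A) \<and> cvec_norm x = 1} \<noteq> {}"
proof -
  have "cvec_norm (unit_vec (dim_col A) 0) = 1"
  proof -
    have "(\<Sum>i<dim_col A. (cmod (unit_vec (dim_col A) 0 $ i))\<^sup>2)
        = (\<Sum>i<dim_col A. if i = 0 then 1 else 0)"
      by (intro sum.cong) auto
    also have "\<dots> = 1" using assms by simp
    finally show ?thesis by (simp add: cvec_norm_def)
  qed
  then show ?thesis by (auto intro!: exI[of _ "unit_vec (dim_col A) 0"])
qed

end

theory Submission
  imports Defs "HOL-Analysis.L2_Norm" "Jordan_Normal_Form.Spectral_Radius"
begin

text \<open>
  The matrices are made to commute one at a time. In an eigenbasis of $H_r$ with eigenvalues
  $\lambda_a$, the commutator $[H_r, K]$ has entries $(\lambda_a - \lambda_b) K_{ab}$. Cut the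
  real line into cells of length $\eta = \sqrt\epsilon$ with a random offset: the pair $(a, b)$ is
  separated with probability at most $|\lambda_a - \lambda_b| / \eta$, so the part of $K$ between
  different cells has expected squared norm at most
  $\frac1n \sum |\lambda_a - \lambda_b| |K_{ab}|^2 / \eta \le \epsilon / \eta$.
  Fix an offset that works for all $K = H_i$ simultaneously, replace $H_r$ by a function of $H_r$
  that is constant on cells and every other $H_i$ by its pinching to the cells. This keeps the
  matrices self-adjoint contractions, makes the new $H_r$ commute with everything, preserves the
  commutation relations achieved before, and increases the commutators of the others only by a
  multiple of the distance moved. After $k$ such steps everything commutes.
\<close>

subsection \<open>Unitary diagonalization of Hermitian matrices\<close>

lemma dim_mat_adjoint [simp]:
  "dim_row (mat_adjoint (A :: complex mat)) = dim_col A"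
  "dim_col (mat_adjoint A) = dim_row A"
  by (simp_all add: mat_adjoint_def)

lemma mat_adjoint_carrier [simp, intro]:
  "A \<in> carrier_mat m n \<Longrightarrow> mat_adjoint (A :: complex mat) \<in> carrier_mat n m"
  by (rule carrier_matI) auto

lemma mat_adjoint_adjoint [simp]: "mat_adjoint (mat_adjoint (A :: complex mat)) = A"
  by (rule eq_matI) (auto simp: index_mat_adjoint)

lemma mat_adjoint_mult:
  fixes A B :: "complex mat"
  assumes "A \<in> carrier_mat m n" "B \<in> carrier_mat n p"
  shows "mat_adjoint (A * B) = mat_adjoint B * mat_adjoint A"
proof (rule eq_matI)
  fix i j assume "i < dim_row (mat_adjoint B * mat_adjoint A)" "j < dim_col (mat_adjoint B * mat_adjoint A)"
  then have "i < p" "j < m" using assms by auto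
  then show "mat_adjoint (A * B) $$ (i, j) = (mat_adjoint B * mat_adjoint A) $$ (i, j)"
    using assms by (simp add: index_mat_adjoint scalar_prod_def mult.commute)
qed (use assms in auto)

lemma cscalar_prod_mult_mat_vec:
  fixes A :: "complex mat"
  assumes "A \<in> carrier_mat m n" "x \<in> carrier_vec n" "y \<in> carrier_vec m"
  shows "(A *\<^sub>v x) \<bullet>c y = x \<bullet>c (mat_adjoint A *\<^sub>v y)"
proof -
  have "(A *\<^sub>v x) \<bullet>c y = (\<Sum>i<m. \<Sum>j<n. A $$ (i, j) * x $ j * cnj (y $ i))"
    using assms by (auto simp: scalar_prod_def sum_distrib_right lessThan_atLeast0 intro!: sum.cong)
  also have "\<dots> = (\<Sum>j<n. \<Sum>i<m. A $$ (i, j) * x $ j * cnj (y $ i))"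
    by (rule sum.swap)
  also have "\<dots> = x \<bullet>c (mat_adjoint A *\<^sub>v y)"
    using assms by (auto simp: scalar_prod_def sum_distrib_left lessThan_atLeast0 index_mat_adjoint
        mult_ac intro!: sum.cong)
  finally show ?thesis .
qed

lemma cvec_norm_nonneg [simp]: "cvec_norm v \<ge> 0"
  by (simp add: cvec_norm_def sum_nonneg)

lemma cvec_norm_sq: "(cvec_norm v)\<^sup>2 = (\<Sum>i<dim_vec v. (cmod (v $ i))\<^sup>2)"
  by (simp add: cvec_norm_def sum_nonneg)

lemma cscalar_prod_self: "v \<bullet>c v = complex_of_real ((cvec_norm v)\<^sup>2)"
  by (simp only: cvec_norm_sq) (simp add: scalar_prod_def complex_norm_square lessThan_atLeast0
      del: of_real_power)

lemma cvec_norm_smult: "cvec_norm (c \<cdot>\<^sub>v v) = cmod c * cvec_norm v"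
  by (simp add: cvec_norm_def norm_mult power_mult_distrib sum_distrib_left [symmetric]
      real_sqrt_mult)

definition unitary_mat :: "nat \<Rightarrow> complex mat \<Rightarrow> bool" where
  "unitary_mat n U \<longleftrightarrow> U \<in> carrier_mat n n \<and> mat_adjoint U * U = 1\<^sub>m n \<and> U * mat_adjoint U = 1\<^sub>m n"

text \<open>For square matrices a left inverse is also a right inverse, so one of the two identities
  suffices.\<close>

lemma unitary_matI:
  assumes "U \<in> carrier_mat n n" "mat_adjoint U * U = 1\<^sub>m n"
  shows "unitary_mat n U"
  using assms mat_mult_left_right_inverse [OF _ assms(1) assms(2)]
  by (auto simp: unitary_mat_def)

lemma unitary_mat_mult:
  assumes U: "unitary_mat n U" and V: "unitary_mat n V"
  shows "unitary_mat n (U * V)"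
proof (rule unitary_matI)
  have c: "U \<in> carrier_mat n n" "V \<in> carrier_mat n n"
    using U V by (auto simp: unitary_mat_def)
  then show "U * V \<in> carrier_mat n n" by auto
  have "mat_adjoint (U * V) * (U * V) = mat_adjoint V * (mat_adjoint U * (U * V))"
    using c by (simp add: mat_adjoint_mult [OF c] assoc_mult_mat [of _ n n _ n _ n]
        mult_carrier_mat [of _ n n _ n])
  also have "mat_adjoint U * (U * V) = (mat_adjoint U * U) * V"
    using c by (simp add: assoc_mult_mat [of _ n n _ n _ n])
  also have "mat_adjoint V * \<dots> = 1\<^sub>m n"
    using U V c by (simp add: unitary_mat_def)
  finally show "mat_adjoint (U * V) * (U * V) = 1\<^sub>m n" .
qed

text \<open>Complete \<open>v\<close> to a basis and apply Gram-Schmidt, which keeps the first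
  vector; normalizing the columns then makes the matrix unitary. This puts an eigenvector into the
  first column for the deflation below.\<close>

lemma unitary_mat_first_column_exists:
  assumes v: "v \<in> carrier_vec n" "v \<noteq> 0\<^sub>v n" and n: "n > 0"
  shows "\<exists>U c. unitary_mat n U \<and> col U 0 = c \<cdot>\<^sub>v v"
proof -
  interpret cof_vec_space n "TYPE(complex)" .
  define b where "b = basis_completion v"
  define ws where "ws = gram_schmidt n b"
  from basis_completion [OF v, folded b_def]
  have dist_b: "distinct b" and indep: "\<not> lin_dep (set b)" and b: "set b \<subseteq> carrier_vec n"
    and hdb: "hd b = v" and len_b: "length b = n" by auto
  from hdb len_b n obtain vs where bv: "b = v # vs" by (cases b) auto
  from gram_schmidt_result [OF b dist_b indep refl, folded ws_def]
  have ws: "set ws \<subseteq> carrier_vec n" "corthogonal ws" "length ws = n"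
    by (auto simp: len_b)
  have wsc: "ws ! i \<in> carrier_vec n" if "i < n" for i
    using ws that by auto
  from gram_schmidt_hd [OF v(1), of vs, folded bv] have hdws: "ws ! 0 = v"
    using n ws(3) unfolding ws_def by (metis hd_conv_nth less_numeral_extra(3) list.size(3))
  \<comment> \<open>The vectors \<open>ws\<close> are orthogonal but not normalized, hence the
    division.\<close>
  define U where "U = mat n n (\<lambda>(i, j). ws ! j $ i / complex_of_real (cvec_norm (ws ! j)))"
  have Uc: "U \<in> carrier_mat n n" by (simp add: U_def)
  \<comment> \<open>\<open>corthogonal\<close> also says that no vector has vanishing product with
    itself.\<close>
  have nz: "cvec_norm (ws ! i) \<noteq> 0" if "i < n" for i
    using corthogonalD [OF ws(2), of i i] that ws(3) cscalar_prod_self [of "ws ! i"] by auto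
  have "mat_adjoint U * U = 1\<^sub>m n"
  proof (rule eq_matI)
    fix i j assume "i < dim_row (1\<^sub>m n)" "j < dim_col (1\<^sub>m n)"
    then have i: "i < n" and j: "j < n" by auto
    have "(mat_adjoint U * U) $$ (i, j)
        = (\<Sum>l<n. ws ! j $ l * cnj (ws ! i $ l)
             / (complex_of_real (cvec_norm (ws ! j)) * complex_of_real (cvec_norm (ws ! i))))"
      using i j by (simp add: U_def index_mat_adjoint scalar_prod_def lessThan_atLeast0 mult_ac)
    also have "\<dots> = (ws ! j \<bullet>c ws ! i)
             / (complex_of_real (cvec_norm (ws ! j)) * complex_of_real (cvec_norm (ws ! i)))"
      using wsc [OF i] by (simp add: scalar_prod_def lessThan_atLeast0 sum_divide_distrib)
    also have "\<dots> = 1\<^sub>m n $$ (i, j)"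
    proof (cases "i = j")
      case True
      then show ?thesis using i nz [OF i]
        by (simp add: cscalar_prod_self power2_eq_square)
    next
      case False
      then show ?thesis using i j corthogonalD [OF ws(2), of j i] ws(3) by simp
    qed
    finally show "(mat_adjoint U * U) $$ (i, j) = 1\<^sub>m n $$ (i, j)" .
  qed (simp_all add: U_def)
  then have "unitary_mat n U" using Uc by (rule unitary_matI [rotated])
  moreover have "col U 0 = (1 / complex_of_real (cvec_norm v)) \<cdot>\<^sub>v v"
    using n v(1) by (intro eq_vecI) (auto simp: U_def hdws)
  ultimately show ?thesis by blast
qed

lemma mat_adjoint_conjugation:
  fixes H U :: "complex mat"
  assumes "H \<in> carrier_mat n n" "U \<in> carrier_mat n n" "mat_adjoint H = H"
  shows "mat_adjoint (mat_adjoint U * H * U) = mat_adjoint U * H * U"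
  using assms by (simp add: mat_adjoint_mult [of _ n n _ n] assoc_mult_mat [of _ n n _ n _ n]
      mult_carrier_mat [of _ n n _ n])

lemma conjugation_mult:
  fixes H U W :: "complex mat"
  assumes "H \<in> carrier_mat n n" "U \<in> carrier_mat n n" "W \<in> carrier_mat n n"
  shows "mat_adjoint (U * W) * H * (U * W) = mat_adjoint W * (mat_adjoint U * H * U) * W"
  using assms by (simp add: mat_adjoint_mult [of _ n n _ n] assoc_mult_mat [of _ n n _ n _ n]
      mult_carrier_mat [of _ n n _ n])

text \<open>Deflation, by induction on the dimension: in a basis starting with an eigenvector the
  first column is a multiple of the first unit vector, self-adjointness gives the same for the first
  row, and the remaining block is Hermitian of smaller size.\<close>

lemma hermitian_unitary_diagonalization:
  assumes "H \<in> carrier_mat n n" "mat_adjoint H = H"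
  shows "\<exists>U. unitary_mat n U \<and> diagonal_mat (mat_adjoint U * H * U)"
  using assms
proof (induction n arbitrary: H)
  case 0
  then have "unitary_mat 0 (1\<^sub>m 0)" "diagonal_mat (mat_adjoint (1\<^sub>m 0) * H * 1\<^sub>m 0)"
    by (auto intro!: unitary_matI simp: diagonal_mat_def)
  then show ?case by blast
next
  case (Suc n)
  note H = \<open>H \<in> carrier_mat (Suc n) (Suc n)\<close> and herm = \<open>mat_adjoint H = H\<close>
  obtain e where "e \<in> spectrum H" using spectrum_non_empty [OF H] by auto
  then obtain v where v: "v \<in> carrier_vec (Suc n)" "v \<noteq> 0\<^sub>v (Suc n)" and Hv: "H *\<^sub>v v = e \<cdot>\<^sub>v v"
    using H by (auto simp: spectrum_def eigenvalue_def eigenvector_def)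
  from unitary_mat_first_column_exists [OF v] obtain U c where U: "unitary_mat (Suc n) U"
    and col: "col U 0 = c \<cdot>\<^sub>v v" by blast
  have Uc: "U \<in> carrier_mat (Suc n) (Suc n)" and UU: "mat_adjoint U * U = 1\<^sub>m (Suc n)"
    using U by (auto simp: unitary_mat_def)
  define A where "A = mat_adjoint U * H * U"
  have Ac: "A \<in> carrier_mat (Suc n) (Suc n)" using Uc H by (auto simp: A_def)
  have Ah: "mat_adjoint A = A"
    unfolding A_def by (rule mat_adjoint_conjugation [OF H Uc herm])
  have HU: "H *\<^sub>v col U 0 = e \<cdot>\<^sub>v col U 0"
    using H v Hv by (simp add: col mult_mat_vec [of _ "Suc n" "Suc n"] smult_smult_assoc mult.commute)
  have c0: "col U 0 \<in> carrier_vec (Suc n)" using Uc col_dim [of U 0] by simp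
  have UH: "mat_adjoint U * H \<in> carrier_mat (Suc n) (Suc n)" using Uc H by auto
  \<comment> \<open>With \<open>u\<close> the first column of \<open>U\<close>, the first column of
    \<open>A\<close> is \<open>mat_adjoint U\<close> applied to \<open>H u = e u\<close>, and
    \<open>mat_adjoint U\<close> sends \<open>u\<close> to the first unit vector.\<close>
  have Acol: "A $$ (i, 0) = (if i = 0 then e else 0)" if i: "i < Suc n" for i
  proof -
    have "col A 0 = mat_adjoint U *\<^sub>v (H *\<^sub>v col U 0)"
      unfolding A_def
      by (rule trans [OF col_mult2 [OF UH Uc zero_less_Suc]
            assoc_mult_mat_vec [OF mat_adjoint_carrier [OF Uc] H c0]])
    also have "\<dots> = e \<cdot>\<^sub>v (mat_adjoint U *\<^sub>v col U 0)"
      unfolding HU by (rule mult_mat_vec [OF mat_adjoint_carrier [OF Uc] c0])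
    also have "mat_adjoint U *\<^sub>v col U 0 = col (mat_adjoint U * U) 0"
      by (rule col_mult2 [OF mat_adjoint_carrier [OF Uc] Uc zero_less_Suc, symmetric])
    finally have "col A 0 $ i = (e \<cdot>\<^sub>v unit_vec (Suc n) 0) $ i"
      using UU by simp
    then show ?thesis using i Ac by (simp add: unit_vec_def)
  qed
  have Arow: "A $$ (0, i) = (if i = 0 then e else 0)" if i: "i < Suc n" for i
  proof (cases "i = 0")
    case True
    then show ?thesis using Acol [of 0] by simp
  next
    case False
    have "A $$ (0, i) = cnj (A $$ (i, 0))"
      using index_mat_adjoint [of 0 A i] Ac i by (simp add: Ah)
    then show ?thesis using Acol [OF i] False by simp
  qed
  define B where "B = mat n n (\<lambda>(i, j). A $$ (Suc i, Suc j))"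
  have Bc: "B \<in> carrier_mat n n" by (simp add: B_def)
  have "mat_adjoint B = B"
  proof (rule eq_matI)
    fix i j assume "i < dim_row B" "j < dim_col B"
    then have ij: "i < n" "j < n" by (auto simp: B_def)
    have "cnj (A $$ (Suc j, Suc i)) = A $$ (Suc i, Suc j)"
      using index_mat_adjoint [of "Suc i" A "Suc j"] Ac ij by (simp add: Ah)
    then show "mat_adjoint B $$ (i, j) = B $$ (i, j)"
      using ij by (simp add: B_def index_mat_adjoint)
  qed (simp_all add: B_def)
  from Suc.IH [OF Bc this] obtain V where V: "unitary_mat n V"
    and dV: "diagonal_mat (mat_adjoint V * B * V)" by blast
  have Vc: "V \<in> carrier_mat n n" and VV: "mat_adjoint V * V = 1\<^sub>m n"
    using V by (auto simp: unitary_mat_def)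
  have VBV: "mat_adjoint V * B \<in> carrier_mat n n"
    using Vc Bc by auto
  define E where "E = mat 1 1 (\<lambda>_. e)"
  have Ec: "E \<in> carrier_mat 1 1" by (simp add: E_def)
  \<comment> \<open>\<open>W\<close> fixes the first coordinate and diagonalizes the lower block, so
    \<open>U * W\<close> diagonalizes \<open>H\<close>.\<close>
  define W where "W = four_block_mat (1\<^sub>m 1) (0\<^sub>m 1 n) (0\<^sub>m n 1) V"
  have Wc: "W \<in> carrier_mat (Suc n) (Suc n)" using Vc by (auto simp: W_def)
  have Wadj: "mat_adjoint W = four_block_mat (1\<^sub>m 1) (0\<^sub>m 1 n) (0\<^sub>m n 1) (mat_adjoint V)"
    by (rule eq_matI) (use Vc in \<open>auto simp: W_def index_mat_adjoint\<close>)
  have Ablock: "A = four_block_mat E (0\<^sub>m 1 n) (0\<^sub>m n 1) B"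
    by (rule eq_matI) (use Ac Acol Arow in \<open>auto simp: B_def E_def\<close>)
  have "mat_adjoint W * W = four_block_mat (1\<^sub>m 1) (0\<^sub>m 1 n) (0\<^sub>m n 1) (1\<^sub>m n)"
    unfolding Wadj using Vc VV
    by (simp only: W_def, subst mult_four_block_mat [of _ 1 1 _ n _ n _ _ 1 _ n]) auto
  also have "\<dots> = 1\<^sub>m (Suc n)" by (rule eq_matI) auto
  finally have Wu: "unitary_mat (Suc n) W" using Wc by (intro unitary_matI)
  have "mat_adjoint W * A = four_block_mat E (0\<^sub>m 1 n) (0\<^sub>m n 1) (mat_adjoint V * B)"
    unfolding Wadj Ablock using Vc Bc Ec
    by (subst mult_four_block_mat [of _ 1 1 _ n _ n _ _ 1 _ n]) auto
  then have "mat_adjoint W * A * W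
      = four_block_mat E (0\<^sub>m 1 n) (0\<^sub>m n 1) (mat_adjoint V * B * V)"
    using Vc VBV Ec
    by (simp only: W_def, subst mult_four_block_mat [of _ 1 1 _ n _ n _ _ 1 _ n]) auto
  moreover have "diagonal_mat \<dots>"
    using dV Vc Ec by (auto simp: diagonal_mat_def)
  moreover have "mat_adjoint (U * W) * H * (U * W) = mat_adjoint W * A * W"
    unfolding A_def by (rule conjugation_mult [OF H Uc Wc])
  ultimately show ?case using unitary_mat_mult [OF U Wu] by metis
qed

text \<open>The diagonal form is again self-adjoint, so its diagonal entries equal their conjugates
  and are real.\<close>

lemma hermitian_spectral:
  assumes H: "H \<in> carrier_mat n n" "mat_adjoint H = H"
  obtains U and l :: "nat \<Rightarrow> real" where "unitary_mat n U"
    "mat_adjoint U * H * U = mat_diag n (\<lambda>i. complex_of_real (l i))"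
proof -
  obtain U where U: "unitary_mat n U" and d: "diagonal_mat (mat_adjoint U * H * U)"
    using hermitian_unitary_diagonalization [OF H] by blast
  define D where "D = mat_adjoint U * H * U"
  have Uc: "U \<in> carrier_mat n n" using U by (simp add: unitary_mat_def)
  have Dc: "D \<in> carrier_mat n n" using Uc H by (auto simp: D_def)
  have Dh: "mat_adjoint D = D"
    unfolding D_def by (rule mat_adjoint_conjugation [OF H(1) Uc H(2)])
  have "D = mat_diag n (\<lambda>i. complex_of_real (Re (D $$ (i, i))))"
  proof (rule eq_matI)
    fix i j assume "i < dim_row (mat_diag n (\<lambda>i. complex_of_real (Re (D $$ (i, i)))))"
      "j < dim_col (mat_diag n (\<lambda>i. complex_of_real (Re (D $$ (i, i)))))"
    then have ij: "i < n" "j < n" by (auto simp: mat_diag_def)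
    have "cnj (D $$ (i, i)) = D $$ (i, i)"
      using index_mat_adjoint [of i D i] Dc ij by (simp add: Dh)
    then have "D $$ (i, i) = complex_of_real (Re (D $$ (i, i)))"
      by (simp add: complex_eq_iff)
    then show "D $$ (i, j) = mat_diag n (\<lambda>i. complex_of_real (Re (D $$ (i, i)))) $$ (i, j)"
      using ij d Dc by (auto simp: mat_diag_def diagonal_mat_def D_def [symmetric])
  qed (use Dc in \<open>auto simp: mat_diag_def\<close>)
  then show ?thesis by (intro that [OF U]) (simp add: D_def)
qed

subsection \<open>Contractions and the normalized Hilbert-Schmidt norm\<close>

text \<open>The operator norm bound in a pointwise form, which passes to products and applies to
  vectors without handling a supremum.\<close>

definition contraction_mat :: "nat \<Rightarrow> complex mat \<Rightarrow> bool" where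
  "contraction_mat n C \<longleftrightarrow> C \<in> carrier_mat n n \<and>
     (\<forall>x\<in>carrier_vec n. cvec_norm (C *\<^sub>v x) \<le> cvec_norm x)"

text \<open>By homogeneity it is enough to test unit vectors. Positive dimension makes the set under
  the supremum nonempty, as the upper bound on \<open>Sup\<close> requires.\<close>

lemma contraction_mat_iff_op_norm:
  assumes C: "C \<in> carrier_mat n n" and n: "n \<ge> 1"
  shows "contraction_mat n C \<longleftrightarrow> mat_op_norm C \<le> 1"
proof
  assume "contraction_mat n C"
  then show "mat_op_norm C \<le> 1"
    unfolding mat_op_norm_def
    using mat_op_norm_set_nonempty [of C] C n
    by (intro cSup_least) (auto simp: contraction_mat_def)
next
  assume le: "mat_op_norm C \<le> 1"
  have "cvec_norm (C *\<^sub>v x) \<le> cvec_norm x" if x: "x \<in> carrier_vec n" for x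
  proof (cases "cvec_norm x = 0")
    case True
    have "x = 0\<^sub>v n"
    proof (rule eq_vecI)
      fix i assume "i < dim_vec (0\<^sub>v n :: complex vec)"
      then show "x $ i = 0\<^sub>v n $ i"
        using cmod_le_cvec_norm [of i x] True x by simp
    qed (use x in auto)
    moreover have "C *\<^sub>v 0\<^sub>v n = 0\<^sub>v n"
      using C by (intro eq_vecI) auto
    ultimately show ?thesis by simp
  next
    case False
    define s where "s = cvec_norm x"
    have s: "s > 0" using False cvec_norm_nonneg [of x] unfolding s_def by linarith
    define y where "y = complex_of_real (1 / s) \<cdot>\<^sub>v x"
    have y: "y \<in> carrier_vec n" "cvec_norm y = 1"
      using x s by (auto simp: y_def cvec_norm_smult norm_divide s_def)
    have "cvec_norm (C *\<^sub>v y) \<le> mat_op_norm C"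
      unfolding mat_op_norm_def
      by (rule cSup_upper [OF _ mat_op_norm_set_bdd_above]) (use y C in auto)
    moreover have "C *\<^sub>v y = complex_of_real (1 / s) \<cdot>\<^sub>v (C *\<^sub>v x)"
      unfolding y_def by (rule mult_mat_vec [OF C x])
    ultimately have "cvec_norm (C *\<^sub>v x) / s \<le> mat_op_norm C"
      using s by (simp add: cvec_norm_smult norm_divide)
    then have "cvec_norm (C *\<^sub>v x) / s \<le> 1" using le by linarith
    then show ?thesis using s by (simp add: s_def [symmetric])
  qed
  then show "contraction_mat n C" using C by (simp add: contraction_mat_def)
qed

lemma unitary_mat_adjoint: "unitary_mat n U \<Longrightarrow> unitary_mat n (mat_adjoint U)"
  by (auto simp: unitary_mat_def)

lemma unitary_mat_contraction:
  assumes U: "unitary_mat n U"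
  shows "contraction_mat n U"
proof -
  have c: "U \<in> carrier_mat n n" and UU: "mat_adjoint U * U = 1\<^sub>m n"
    using U by (auto simp: unitary_mat_def)
  have "cvec_norm (U *\<^sub>v x) \<le> cvec_norm x" if x: "x \<in> carrier_vec n" for x
  proof -
    have Ux: "U *\<^sub>v x \<in> carrier_vec n" using c x by auto
    have "mat_adjoint U *\<^sub>v (U *\<^sub>v x) = x"
      using assoc_mult_mat_vec [OF mat_adjoint_carrier [OF c] c x] x by (simp add: UU)
    then have "(U *\<^sub>v x) \<bullet>c (U *\<^sub>v x) = x \<bullet>c x"
      using cscalar_prod_mult_mat_vec [OF c x Ux] by simp
    then have "(cvec_norm (U *\<^sub>v x))\<^sup>2 = (cvec_norm x)\<^sup>2"
      unfolding cscalar_prod_self by (simp only: of_real_eq_iff)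
    then show ?thesis by simp
  qed
  then show ?thesis using c by (simp add: contraction_mat_def)
qed

lemma contraction_mat_mult:
  assumes "contraction_mat n A" "contraction_mat n B"
  shows "contraction_mat n (A * B)"
proof -
  have c: "A \<in> carrier_mat n n" "B \<in> carrier_mat n n"
    using assms by (auto simp: contraction_mat_def)
  have "cvec_norm (A * B *\<^sub>v x) \<le> cvec_norm x" if x: "x \<in> carrier_vec n" for x
  proof -
    have "B *\<^sub>v x \<in> carrier_vec n" using c x by auto
    then have "cvec_norm (A *\<^sub>v (B *\<^sub>v x)) \<le> cvec_norm (B *\<^sub>v x)"
      using assms(1) by (simp add: contraction_mat_def)
    also have "\<dots> \<le> cvec_norm x"
      using assms(2) x by (simp add: contraction_mat_def)
    finally show ?thesis by (simp add: assoc_mult_mat_vec [OF c x])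
  qed
  then show ?thesis using c by (simp add: contraction_mat_def mult_carrier_mat [OF c])
qed

text \<open>The column form suits multiplication from the left, which acts on each column
  separately.\<close>

lemma mat_tr_norm_cols:
  assumes "A \<in> carrier_mat n n"
  shows "mat_tr_norm A = sqrt (1 / real n * (\<Sum>k<n. (cvec_norm (col A k))\<^sup>2))"
proof -
  have "(\<Sum>j<n. \<Sum>k<n. (cmod (A $$ (j, k)))\<^sup>2) = (\<Sum>k<n. \<Sum>j<n. (cmod (A $$ (j, k)))\<^sup>2)"
    by (rule sum.swap)
  also have "\<dots> = (\<Sum>k<n. (cvec_norm (col A k))\<^sup>2)"
    using assms by (intro sum.cong refl) (simp add: cvec_norm_sq)
  finally show ?thesis using assms by (simp add: mat_tr_norm_def)
qed

text \<open>This form gives access to Minkowski's inequality.\<close>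

lemma mat_tr_norm_L2_set:
  assumes "A \<in> carrier_mat n n"
  shows "mat_tr_norm A = L2_set (\<lambda>p. cmod (A $$ p)) ({..<n} \<times> {..<n}) / sqrt (real n)"
  using assms
  by (simp add: mat_tr_norm_def L2_set_def sum.cartesian_product real_sqrt_divide case_prod_beta)

lemma mat_tr_norm_nonneg [simp]: "mat_tr_norm A \<ge> 0"
  by (simp add: mat_tr_norm_def sum_nonneg)

lemma mat_tr_norm_sq:
  assumes "A \<in> carrier_mat n n" "n \<ge> 1"
  shows "(\<Sum>a<n. \<Sum>b<n. (cmod (A $$ (a, b)))\<^sup>2) = real n * (mat_tr_norm A)\<^sup>2"
  using assms by (simp add: mat_tr_norm_def sum_nonneg)

lemma mat_tr_norm_le_iff:
  assumes "A \<in> carrier_mat n n" "n \<ge> 1" "s \<ge> 0"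
  shows "mat_tr_norm A \<le> s \<longleftrightarrow> (\<Sum>a<n. \<Sum>b<n. (cmod (A $$ (a, b)))\<^sup>2) \<le> real n * s\<^sup>2"
  using assms by (simp add: mat_tr_norm_sq abs_le_square_iff [symmetric])

lemma mat_tr_norm_triangle:
  assumes "A \<in> carrier_mat n n" "B \<in> carrier_mat n n" "C \<in> carrier_mat n n"
  shows "mat_tr_norm (A - C) \<le> mat_tr_norm (A - B) + mat_tr_norm (B - C)"
proof -
  let ?S = "{..<n} \<times> {..<n}"
  have "L2_set (\<lambda>p. cmod ((A - C) $$ p)) ?S
      \<le> L2_set (\<lambda>p. cmod ((A - B) $$ p) + cmod ((B - C) $$ p)) ?S"
  proof (rule L2_set_mono)
    fix p assume "p \<in> ?S"
    then show "cmod ((A - C) $$ p) \<le> cmod ((A - B) $$ p) + cmod ((B - C) $$ p)"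
      using assms norm_triangle_ineq [of "A $$ p - B $$ p" "B $$ p - C $$ p"] by auto
  qed simp
  also have "\<dots> \<le> L2_set (\<lambda>p. cmod ((A - B) $$ p)) ?S + L2_set (\<lambda>p. cmod ((B - C) $$ p)) ?S"
    by (rule L2_set_triangle_ineq)
  finally show ?thesis
    unfolding mat_tr_norm_L2_set [OF minus_carrier_mat [OF assms(2)]]
      mat_tr_norm_L2_set [OF minus_carrier_mat [OF assms(3)]]
    by (simp add: add_divide_distrib [symmetric] divide_right_mono)
qed

lemma mat_tr_norm_minus_commute:
  assumes "A \<in> carrier_mat n n" "B \<in> carrier_mat n n"
  shows "mat_tr_norm (A - B) = mat_tr_norm (B - A)"
  using assms by (simp add: mat_tr_norm_def norm_minus_commute)

lemma mat_tr_norm_adjoint: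
  assumes "A \<in> carrier_mat n n"
  shows "mat_tr_norm (mat_adjoint A) = mat_tr_norm A"
proof -
  have "(\<Sum>j<n. \<Sum>k<n. (cmod (A $$ (k, j)))\<^sup>2) = (\<Sum>j<n. \<Sum>k<n. (cmod (A $$ (j, k)))\<^sup>2)"
    by (rule sum.swap)
  then show ?thesis using assms by (simp add: mat_tr_norm_def index_mat_adjoint)
qed

lemma mat_tr_norm_contraction_left:
  assumes C: "contraction_mat n C" and X: "X \<in> carrier_mat n n"
  shows "mat_tr_norm (C * X) \<le> mat_tr_norm X"
proof -
  have Cc: "C \<in> carrier_mat n n" using C by (simp add: contraction_mat_def)
  have "(cvec_norm (col (C * X) k))\<^sup>2 \<le> (cvec_norm (col X k))\<^sup>2" if k: "k < n" for k
  proof -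
    have "col X k \<in> carrier_vec n" using X col_dim [of X k] by simp
    then show ?thesis
      using C unfolding col_mult2 [OF Cc X k]
      by (intro power_mono) (auto simp: contraction_mat_def)
  qed
  then have "(\<Sum>k<n. (cvec_norm (col (C * X) k))\<^sup>2) \<le> (\<Sum>k<n. (cvec_norm (col X k))\<^sup>2)"
    by (intro sum_mono) auto
  then show ?thesis
    unfolding mat_tr_norm_cols [OF mult_carrier_mat [OF Cc X]] mat_tr_norm_cols [OF X]
    by (intro real_sqrt_le_mono mult_left_mono) auto
qed

text \<open>Taking adjoints preserves the norm and turns right multiplication by \<open>C\<close>
  into left multiplication by its adjoint, which is why the hypothesis concerns the adjoint.\<close>

lemma mat_tr_norm_contraction_right:
  assumes C: "contraction_mat n (mat_adjoint C)" and X: "X \<in> carrier_mat n n"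
  shows "mat_tr_norm (X * C) \<le> mat_tr_norm X"
proof -
  have Cc: "C \<in> carrier_mat n n"
    using C mat_adjoint_carrier [of "mat_adjoint C" n n] by (simp add: contraction_mat_def)
  have "mat_tr_norm (X * C) = mat_tr_norm (mat_adjoint C * mat_adjoint X)"
    using mat_tr_norm_adjoint [OF mult_carrier_mat [OF X Cc]] by (simp add: mat_adjoint_mult [OF X Cc])
  also have "\<dots> \<le> mat_tr_norm (mat_adjoint X)"
    by (rule mat_tr_norm_contraction_left [OF C mat_adjoint_carrier [OF X]])
  finally show ?thesis by (simp add: mat_tr_norm_adjoint [OF X])
qed

section \<open>Hermitian contractions and stability of commutators\<close>

definition hermitian_contraction :: "nat \<Rightarrow> complex mat \<Rightarrow> bool" where
  "hermitian_contraction n K \<longleftrightarrow> contraction_mat n K \<and> mat_adjoint K = K"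

lemma hermitian_contraction_carrier: "hermitian_contraction n K \<Longrightarrow> K \<in> carrier_mat n n"
  by (simp add: hermitian_contraction_def contraction_mat_def)

lemma mat_tr_norm_mult_diff:
  assumes "hermitian_contraction n X" "Y \<in> carrier_mat n n"
    "X' \<in> carrier_mat n n" "hermitian_contraction n Y'"
  shows "mat_tr_norm (X * Y - X' * Y') \<le> mat_tr_norm (X - X') + mat_tr_norm (Y - Y')"
proof -
  have c: "X \<in> carrier_mat n n" "Y' \<in> carrier_mat n n"
    using assms by (simp_all add: hermitian_contraction_carrier)
  note c = c assms(2,3)
  have "mat_tr_norm (X * Y - X' * Y')
      \<le> mat_tr_norm (X * Y - X * Y') + mat_tr_norm (X * Y' - X' * Y')"
    using c by (intro mat_tr_norm_triangle [of _ n]) auto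
  also have "X * Y - X * Y' = X * (Y - Y')"
    using c by (simp add: mult_minus_distrib_mat [of _ n n _ n])
  also have "X * Y' - X' * Y' = (X - X') * Y'"
    using c by (simp add: minus_mult_distrib_mat [of _ n n])
  also have "mat_tr_norm (X * (Y - Y')) \<le> mat_tr_norm (Y - Y')"
    using assms c by (intro mat_tr_norm_contraction_left [of n])
      (auto simp: hermitian_contraction_def intro!: minus_carrier_mat)
  also have "mat_tr_norm ((X - X') * Y') \<le> mat_tr_norm (X - X')"
    using assms c by (intro mat_tr_norm_contraction_right [of n])
      (auto simp: hermitian_contraction_def intro!: minus_carrier_mat)
  finally show ?thesis by simp
qed

text \<open>Both products in the commutator move by at most the sum of the two displacements, whence
  the factors 2.\<close>

lemma mat_tr_norm_commutator_perturb:
  assumes "hermitian_contraction n X" "hermitian_contraction n Y"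
    "hermitian_contraction n X'" "hermitian_contraction n Y'"
  shows "mat_tr_norm (mat_commutator X' Y')
    \<le> mat_tr_norm (mat_commutator X Y) + 2 * mat_tr_norm (X - X') + 2 * mat_tr_norm (Y - Y')"
proof -
  note c = assms [THEN hermitian_contraction_carrier]
  have p: "X * Y \<in> carrier_mat n n" "Y * X \<in> carrier_mat n n"
    "X' * Y' \<in> carrier_mat n n" "Y' * X' \<in> carrier_mat n n"
    using c by auto
  have "mat_tr_norm (X' * Y' - Y' * X')
      \<le> mat_tr_norm (X' * Y' - X * Y) + mat_tr_norm (X * Y - Y' * X')"
    by (rule mat_tr_norm_triangle [OF p(3,1,4)])
  moreover have "mat_tr_norm (X * Y - Y' * X')
      \<le> mat_tr_norm (X * Y - Y * X) + mat_tr_norm (Y * X - Y' * X')"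
    by (rule mat_tr_norm_triangle [OF p(1,2,4)])
  moreover have "mat_tr_norm (X' * Y' - X * Y) \<le> mat_tr_norm (X - X') + mat_tr_norm (Y - Y')"
    using mat_tr_norm_mult_diff [OF assms(1) c(2,3) assms(4)] mat_tr_norm_minus_commute [OF p(3,1)]
    by simp
  moreover have "mat_tr_norm (Y * X - Y' * X') \<le> mat_tr_norm (Y - Y') + mat_tr_norm (X - X')"
    by (rule mat_tr_norm_mult_diff [OF assms(2) c(1,4) assms(3)])
  ultimately show ?thesis unfolding mat_commutator_def by linarith
qed

subsection \<open>Cells separating few pairs of eigenvalues\<close>

text \<open>Hermite's identity for the floor function, in integer form.\<close>

lemma sum_shifted_div:
  fixes m :: int
  assumes N: "N > 0"
  shows "(\<Sum>t<N. (m + int t) div int N) = m"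
proof -
  \<comment> \<open>Raising \<open>m\<close> by one shifts the window of summation: the term
    \<open>m div N\<close> leaves and \<open>(m + N) div N = m div N + 1\<close> enters.\<close>
  have step: "(\<Sum>t<N. (m + 1 + int t) div int N) = (\<Sum>t<N. (m + int t) div int N) + 1" for m
  proof -
    have "(\<Sum>t<N. (m + 1 + int t) div int N) + m div int N
        = (\<Sum>t<Suc N. (m + int t) div int N)"
      by (subst sum.lessThan_Suc_shift) (simp add: algebra_simps)
    also have "\<dots> = (\<Sum>t<N. (m + int t) div int N) + (m div int N + 1)"
      using N by simp
    finally show ?thesis by simp
  qed
  show ?thesis
  proof (induction m rule: int_induct [where k = 0])
    case base
    show ?case by simp
  next
    case (step1 i)
    then show ?case using step [of i] by simp
  next
    case (step2 i)
    then show ?case using step [of "i - 1"] by simp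
  qed
qed

text \<open>Each separating shift contributes at least 1 to the sum of the differences of the two
  quotients, and by Hermite's identity that sum is the distance. This is the discrete form of the
  bound on the separation probability.\<close>

lemma sum_separating_shifts_le:
  fixes m m' :: int
  assumes N: "N > 0"
  shows "(\<Sum>t<N. if (m + int t) div int N = (m' + int t) div int N then 0 else 1) \<le> \<bar>m - m'\<bar>"
proof -
  have *: "(\<Sum>t<N. if (m + int t) div int N = (m' + int t) div int N then 0 else 1) \<le> m' - m"
    if le: "m \<le> m'" for m m' :: int
  proof -
    have "(\<Sum>t<N. if (m + int t) div int N = (m' + int t) div int N then 0 else 1)
        \<le> (\<Sum>t<N. (m' + int t) div int N - (m + int t) div int N)"
    proof (rule sum_mono)
      fix t
      have "(m + int t) div int N \<le> (m' + int t) div int N"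
        using le N by (intro zdiv_mono1) auto
      then show "(if (m + int t) div int N = (m' + int t) div int N then 0 else 1)
          \<le> (m' + int t) div int N - (m + int t) div int N" by auto
    qed
    also have "\<dots> = m' - m"
      using N by (simp add: sum_subtractf sum_shifted_div)
    finally show ?thesis .
  qed
  show ?thesis
  proof (cases "m \<le> m'")
    case True
    then show ?thesis using * [OF True] by simp
  next
    case False
    have "(\<Sum>t<N. if (m + int t) div int N = (m' + int t) div int N then 0 else 1 :: int)
        = (\<Sum>t<N. if (m' + int t) div int N = (m + int t) div int N then 0 else 1)"
      by (intro sum.cong) auto
    then show ?thesis using * [of m' m] False by simp
  qed
qed

lemma abs_floor_diff_le: "real_of_int \<bar>\<lfloor>u\<rfloor> - \<lfloor>v\<rfloor>\<bar> \<le> \<bar>u - v\<bar> + 1" for u v :: real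
  unfolding of_int_abs of_int_diff
  using floor_correct [of u] floor_correct [of v] by (simp add: abs_le_iff) linarith

text \<open>Replaces the random offset by a definite one: some value does not exceed the
  average.\<close>

lemma exists_le_average:
  fixes F :: "nat \<Rightarrow> real"
  assumes "N > 0" "(\<Sum>t<N. F t) \<le> real N * B"
  shows "\<exists>t<N. F t \<le> B"
proof (rule ccontr)
  assume "\<not> ?thesis"
  then have "(\<Sum>t<N. B) < (\<Sum>t<N. F t)"
    using assms(1) by (intro sum_strict_mono) auto
  then show False using assms(2) by simp
qed

text \<open>Here \<open>c\<close> gives the cell of a point and \<open>g\<close> a representative of
  each cell. Averaged over the offsets, the separated weight is at most \<open>near\<close> divided
  by \<eta> plus a rounding term paid for by \<open>total\<close>; some offset does at least as
  well.\<close>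

lemma good_cells_exist:
  fixes l :: "nat \<Rightarrow> real" and w :: "nat \<Rightarrow> nat \<Rightarrow> real"
  assumes w: "\<And>a b. w a b \<ge> 0" and eps: "\<epsilon> > 0" and eta: "\<eta> > 0"
    and near: "(\<Sum>a<n. \<Sum>b<n. \<bar>l a - l b\<bar> * w a b) \<le> \<epsilon> * M"
    and total: "(\<Sum>a<n. \<Sum>b<n. w a b) \<le> M"
  shows "\<exists>(c :: real \<Rightarrow> int) (g :: int \<Rightarrow> real). (\<forall>x. \<bar>g (c x) - x\<bar> \<le> \<eta>) \<and>
    (\<Sum>a<n. \<Sum>b<n. if c (l a) = c (l b) then 0 else w a b) \<le> 2 * \<epsilon> / \<eta> * M"
proof -
  \<comment> \<open>The random offset is discretized to the multiples of $\eta / N$; the rounding adds $1 / N$ to the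
    separation probability, so $N \ge \eta / \epsilon$ only doubles the bound.\<close>
  define N where "N = nat \<lceil>\<eta> / \<epsilon>\<rceil>"
  have "\<eta> / \<epsilon> > 0" using eps eta by simp
  then have N: "N > 0" and Nge: "real N \<ge> \<eta> / \<epsilon>"
    by (auto simp: N_def)
  then have N1: "1 \<le> real N * (\<epsilon> / \<eta>)"
    using eps eta by (simp add: field_simps)
  have M: "M \<ge> 0" using total w by (meson order_trans sum_nonneg)
  \<comment> \<open>\<open>m x\<close> locates \<open>x\<close> on the grid of mesh
    \<open>\<eta> / N\<close>; a cell consists of \<open>N\<close> consecutive mesh intervals, and
    \<open>t\<close> shifts the cell boundaries.\<close>
  define m where "m = (\<lambda>x. \<lfloor>real N * x / \<eta>\<rfloor>)"
  define c where "c = (\<lambda>t x. (m x + int t) div int N)"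
  define F where "F = (\<lambda>t. \<Sum>a<n. \<Sum>b<n. if c t (l a) = c t (l b) then 0 else w a b)"
  have sep: "(\<Sum>t<N. if c t x = c t y then 0 else 1) \<le> real N / \<eta> * \<bar>x - y\<bar> + 1" for x y
  proof -
    have "(\<Sum>t<N. if c t x = c t y then 0 else 1 :: real)
        = real_of_int (\<Sum>t<N. if c t x = c t y then 0 else 1)"
      by (simp add: if_distrib [of real_of_int] cong: if_cong)
    also have "\<dots> \<le> real_of_int \<bar>m x - m y\<bar>"
      unfolding c_def of_int_le_iff by (rule sum_separating_shifts_le [OF N])
    also have "\<dots> \<le> \<bar>real N * x / \<eta> - real N * y / \<eta>\<bar> + 1"
      unfolding m_def by (rule abs_floor_diff_le)
    also have "real N * x / \<eta> - real N * y / \<eta> = real N / \<eta> * (x - y)"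
      by (simp add: right_diff_distrib diff_divide_distrib)
    finally show ?thesis using eta by (simp add: abs_mult)
  qed
  have "(\<Sum>t<N. F t) = (\<Sum>a<n. \<Sum>t<N. \<Sum>b<n. if c t (l a) = c t (l b) then 0 else w a b)"
    unfolding F_def by (rule sum.swap)
  also have "\<dots> = (\<Sum>a<n. \<Sum>b<n. \<Sum>t<N. if c t (l a) = c t (l b) then 0 else w a b)"
    by (intro sum.cong refl sum.swap)
  also have "\<dots> = (\<Sum>a<n. \<Sum>b<n. w a b * (\<Sum>t<N. if c t (l a) = c t (l b) then 0 else 1))"
    by (intro sum.cong refl) (auto simp: sum_distrib_left intro!: sum.cong)
  also have "\<dots> \<le> (\<Sum>a<n. \<Sum>b<n. w a b * (real N / \<eta> * \<bar>l a - l b\<bar> + 1))"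
    using w sep by (intro sum_mono mult_left_mono) auto
  also have "\<dots> = real N / \<eta> * (\<Sum>a<n. \<Sum>b<n. \<bar>l a - l b\<bar> * w a b) + (\<Sum>a<n. \<Sum>b<n. w a b)"
    by (simp add: sum_distrib_left sum.distrib algebra_simps)
  also have "\<dots> \<le> real N / \<eta> * (\<epsilon> * M) + 1 * M"
    using near total eta by (intro add_mono mult_left_mono) auto
  also have "\<dots> \<le> real N / \<eta> * (\<epsilon> * M) + (real N * (\<epsilon> / \<eta>)) * M"
    using N1 M by (intro add_left_mono mult_right_mono)
  also have "\<dots> = real N * (2 * \<epsilon> / \<eta> * M)" by simp
  finally obtain t where t: "t < N" "F t \<le> 2 * \<epsilon> / \<eta> * M"
    using exists_le_average [OF N] by blast
  \<comment> \<open>The representative is the left endpoint of cell \<open>j\<close>.\<close>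
  define g where "g = (\<lambda>j. \<eta> * (real_of_int j - real t / real N))"
  have "\<bar>g (c t x) - x\<bar> \<le> \<eta>" for x
  proof -
    define j where "j = c t x"
    have "int N * j \<le> m x + int t" "m x + int t < int N * j + int N"
    proof -
      have "m x + int t = int N * j + (m x + int t) mod int N"
        by (simp add: j_def c_def)
      moreover have "0 \<le> (m x + int t) mod int N" "(m x + int t) mod int N < int N"
        using N by auto
      ultimately show "int N * j \<le> m x + int t" "m x + int t < int N * j + int N" by linarith+
    qed
    \<comment> \<open>The strict integer inequality is sharpened by 1, which absorbs the rounding in
      \<open>m x\<close>.\<close>
    then have j: "real_of_int (int N * j) \<le> real_of_int (m x + int t)"
      "real_of_int (m x + int t + 1) \<le> real_of_int (int N * j + int N)"
      by (simp_all only: of_int_le_iff)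
    have mx: "real_of_int (m x) \<le> real N * x / \<eta>" "real N * x / \<eta> \<le> real_of_int (m x) + 1"
      using floor_correct [of "real N * x / \<eta>"] unfolding m_def by auto
    have "real N * j \<le> real N * x / \<eta> + real t" "real N * x / \<eta> + real t \<le> real N * j + real N"
      using j mx by auto
    then have "j - t / N \<le> x / \<eta>" "x / \<eta> \<le> j - t / N + 1"
      using N by (auto simp: field_simps)
    then have "\<eta> * (j - t / N) \<le> x" "x \<le> \<eta> * (j - t / N) + \<eta>"
      using eta by (auto simp: field_simps)
    then show ?thesis by (simp add: g_def j_def)
  qed
  then show ?thesis using t(2) unfolding F_def by blast
qed

subsection \<open>Pinching\<close>

text \<open>The block-diagonal part of \<open>K\<close> for the partition of the indices into level
  sets of \<open>c\<close>, that is, the sum of \<open>P K P\<close> over the coordinate projections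
  \<open>P\<close> of the blocks.\<close>

definition pinch :: "(nat \<Rightarrow> int) \<Rightarrow> complex mat \<Rightarrow> complex mat" where
  "pinch c K = mat (dim_row K) (dim_col K) (\<lambda>(a, b). if c a = c b then K $$ (a, b) else 0)"

lemma dim_pinch [simp]: "dim_row (pinch c K) = dim_row K" "dim_col (pinch c K) = dim_col K"
  by (simp_all add: pinch_def)

lemma pinch_carrier: "K \<in> carrier_mat m n \<Longrightarrow> pinch c K \<in> carrier_mat m n"
  by (rule carrier_matI) auto

lemma index_pinch:
  "a < dim_row K \<Longrightarrow> b < dim_col K \<Longrightarrow> pinch c K $$ (a, b) = (if c a = c b then K $$ (a, b) else 0)"
  by (simp add: pinch_def)

lemma mat_adjoint_pinch:
  assumes "K \<in> carrier_mat n n"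
  shows "mat_adjoint (pinch c K) = pinch c (mat_adjoint K)"
  by (rule eq_matI) (use assms in \<open>auto simp: index_mat_adjoint index_pinch\<close>)

text \<open>The rows of a block see only the part of \<open>x\<close> supported on that block. Apply
  the contraction bound to each part and add the squares, using that the parts are
  orthogonal.\<close>

lemma contraction_mat_pinch:
  assumes K: "contraction_mat n K"
  shows "contraction_mat n (pinch c K)"
proof -
  have Kc: "K \<in> carrier_mat n n" and Kn: "\<And>x. x \<in> carrier_vec n \<Longrightarrow> cvec_norm (K *\<^sub>v x) \<le> cvec_norm x"
    using K by (auto simp: contraction_mat_def)
  have "cvec_norm (pinch c K *\<^sub>v x) \<le> cvec_norm x" if x: "x \<in> carrier_vec n" for x
  proof -
    define y where "y = (\<lambda>q. vec n (\<lambda>b. if c b = q then x $ b else 0))"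
    have y: "y q \<in> carrier_vec n" for q by (simp add: y_def)
    have ent: "(pinch c K *\<^sub>v x) $ a = (K *\<^sub>v y (c a)) $ a" if a: "a < n" for a
      using a Kc x
      by (auto simp: scalar_prod_def y_def index_pinch intro!: sum.cong)
    have "(cvec_norm (pinch c K *\<^sub>v x))\<^sup>2 = (\<Sum>a<n. (cmod ((K *\<^sub>v y (c a)) $ a))\<^sup>2)"
      using Kc ent by (simp add: cvec_norm_sq del: index_mult_mat_vec)
    also have "\<dots> = (\<Sum>q\<in>c ` {..<n}. \<Sum>a\<in>{a \<in> {..<n}. c a = q}. (cmod ((K *\<^sub>v y (c a)) $ a))\<^sup>2)"
      by (rule sum.image_gen) simp
    also have "\<dots> \<le> (\<Sum>q\<in>c ` {..<n}. (cvec_norm (y q))\<^sup>2)"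
    proof (rule sum_mono)
      fix q
      have "(\<Sum>a\<in>{a \<in> {..<n}. c a = q}. (cmod ((K *\<^sub>v y (c a)) $ a))\<^sup>2)
          = (\<Sum>a\<in>{a \<in> {..<n}. c a = q}. (cmod ((K *\<^sub>v y q) $ a))\<^sup>2)"
        by (intro sum.cong) auto
      \<comment> \<open>Rows outside the block are added so that the bound for \<open>K\<close>
        itself applies.\<close>
      also have "\<dots> \<le> (\<Sum>a<n. (cmod ((K *\<^sub>v y q) $ a))\<^sup>2)"
        by (intro sum_mono2) auto
      also have "\<dots> = (cvec_norm (K *\<^sub>v y q))\<^sup>2"
        using Kc by (simp add: cvec_norm_sq)
      also have "\<dots> \<le> (cvec_norm (y q))\<^sup>2"
        using Kn [OF y] by (intro power_mono) auto
      finally show "(\<Sum>a\<in>{a \<in> {..<n}. c a = q}. (cmod ((K *\<^sub>v y (c a)) $ a))\<^sup>2) \<le> (cvec_norm (y q))\<^sup>2" .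
    qed
    also have "\<dots> = (\<Sum>q\<in>c ` {..<n}. \<Sum>b\<in>{b \<in> {..<n}. c b = q}. (cmod (x $ b))\<^sup>2)"
    proof (rule sum.cong [OF refl])
      fix q
      have "(cvec_norm (y q))\<^sup>2 = (\<Sum>b<n. if c b = q then (cmod (x $ b))\<^sup>2 else 0)"
        by (auto simp: cvec_norm_sq y_def intro!: sum.cong)
      also have "\<dots> = (\<Sum>b\<in>{b \<in> {..<n}. c b = q}. (cmod (x $ b))\<^sup>2)"
        by (rule sum.inter_filter [symmetric]) simp
      finally show "(cvec_norm (y q))\<^sup>2 = \<dots>" .
    qed
    also have "\<dots> = (\<Sum>b<n. (cmod (x $ b))\<^sup>2)"
      by (rule sum.image_gen [symmetric]) simp
    also have "\<dots> = (cvec_norm x)\<^sup>2" using x by (simp add: cvec_norm_sq)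
    finally show ?thesis by (rule power2_le_imp_le) simp
  qed
  then show ?thesis using pinch_carrier [OF Kc] by (simp add: contraction_mat_def)
qed

text \<open>A block-diagonal \<open>L\<close> maps each block to itself, so multiplying by it
  commutes with pinching. With its mirror image below, this lets pinching preserve commutation with
  \<open>L\<close>.\<close>

lemma pinch_mult_left:
  assumes L: "L \<in> carrier_mat n n" "pinch c L = L" and K: "K \<in> carrier_mat n n"
  shows "L * pinch c K = pinch c (L * K)"
proof (rule eq_matI)
  fix a b assume "a < dim_row (pinch c (L * K))" "b < dim_col (pinch c (L * K))"
  then have ab: "a < n" "b < n" using L K by auto
  have L0: "L $$ (a, d) = 0" if "d < n" "c a \<noteq> c d" for d
    using index_pinch [of a L d c] that ab L by simp
  have "(L * pinch c K) $$ (a, b) = (\<Sum>d = 0..<n. L $$ (a, d) * (if c d = c b then K $$ (d, b) else 0))"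
    using ab L K by (simp add: scalar_prod_def index_pinch)
  also have "\<dots> = (if c a = c b then \<Sum>d = 0..<n. L $$ (a, d) * K $$ (d, b) else 0)"
    using L0 by (auto intro!: sum.cong sum.neutral)
  also have "\<dots> = pinch c (L * K) $$ (a, b)"
    using ab L K by (simp add: scalar_prod_def index_pinch)
  finally show "(L * pinch c K) $$ (a, b) = pinch c (L * K) $$ (a, b)" .
qed (use L K in auto)

lemma pinch_mult_right:
  assumes L: "L \<in> carrier_mat n n" "pinch c L = L" and K: "K \<in> carrier_mat n n"
  shows "pinch c K * L = pinch c (K * L)"
proof (rule eq_matI)
  fix a b assume "a < dim_row (pinch c (K * L))" "b < dim_col (pinch c (K * L))"
  then have ab: "a < n" "b < n" using L K by auto
  have L0: "L $$ (d, b) = 0" if "d < n" "c d \<noteq> c b" for d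
    using index_pinch [of d L b c] that ab L by simp
  have "(pinch c K * L) $$ (a, b) = (\<Sum>d = 0..<n. (if c a = c d then K $$ (a, d) else 0) * L $$ (d, b))"
    using ab L K by (simp add: scalar_prod_def index_pinch)
  also have "\<dots> = (if c a = c b then \<Sum>d = 0..<n. K $$ (a, d) * L $$ (d, b) else 0)"
    using L0 by (auto intro!: sum.cong sum.neutral)
  also have "\<dots> = pinch c (K * L) $$ (a, b)"
    using ab L K by (simp add: scalar_prod_def index_pinch)
  finally show "(pinch c K * L) $$ (a, b) = pinch c (K * L) $$ (a, b)" .
qed (use L K in auto)

section \<open>Entries of contractions, and diagonal matrices\<close>

lemma contraction_mat_col:
  assumes K: "contraction_mat n K" and a: "a < n"
  shows "cvec_norm (col K a) \<le> 1"
proof -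
  have Kc: "K \<in> carrier_mat n n" using K by (simp add: contraction_mat_def)
  have u: "cvec_norm (unit_vec n a) = 1"
  proof -
    have "(\<Sum>i<n. (cmod (unit_vec n a $ i))\<^sup>2) = (\<Sum>i<n. if i = a then 1 else 0)"
      using a by (intro sum.cong) (auto simp: unit_vec_def)
    then show ?thesis using a by (simp add: cvec_norm_def)
  qed
  have "K *\<^sub>v unit_vec n a = col K a"
    using Kc a by (intro eq_vecI) auto
  moreover have "cvec_norm (K *\<^sub>v unit_vec n a) \<le> cvec_norm (unit_vec n a)"
    using K by (simp add: contraction_mat_def)
  ultimately show ?thesis using u by simp
qed

lemma contraction_mat_entry:
  assumes "contraction_mat n K" "a < n" "b < n"
  shows "cmod (K $$ (a, b)) \<le> 1"
  using contraction_mat_col [OF assms(1,3)] cmod_le_cvec_norm [of a "col K b"] assms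
  by (auto simp: contraction_mat_def)

lemma contraction_mat_entries_sq:
  assumes "contraction_mat n K"
  shows "(\<Sum>a<n. \<Sum>b<n. (cmod (K $$ (a, b)))\<^sup>2) \<le> real n"
proof -
  have "(\<Sum>a<n. \<Sum>b<n. (cmod (K $$ (a, b)))\<^sup>2) = (\<Sum>b<n. \<Sum>a<n. (cmod (K $$ (a, b)))\<^sup>2)"
    by (rule sum.swap)
  also have "\<dots> = (\<Sum>b<n. (cvec_norm (col K b))\<^sup>2)"
    using assms by (intro sum.cong refl) (auto simp: cvec_norm_sq contraction_mat_def)
  also have "\<dots> \<le> (\<Sum>b<n. 1)"
    using contraction_mat_col [OF assms] by (intro sum_mono power_le_one) auto
  finally show ?thesis by simp
qed

lemma contraction_mat_diag:
  assumes "\<And>a. a < n \<Longrightarrow> \<bar>f a\<bar> \<le> 1"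
  shows "contraction_mat n (mat_diag n (\<lambda>a. complex_of_real (f a)))"
proof -
  let ?D = "mat_diag n (\<lambda>a. complex_of_real (f a))"
  have "cvec_norm (?D *\<^sub>v x) \<le> cvec_norm x" if x: "x \<in> carrier_vec n" for x
  proof -
    have ent: "(?D *\<^sub>v x) $ a = complex_of_real (f a) * x $ a" if a: "a < n" for a
    proof -
      have "(?D *\<^sub>v x) $ a = (\<Sum>b = 0..<n. (if a = b then complex_of_real (f b) else 0) * x $ b)"
        using a x by (simp add: mat_diag_def scalar_prod_def)
      also have "\<dots> = (\<Sum>b = 0..<n. if a = b then complex_of_real (f b) * x $ b else 0)"
        by (intro sum.cong) auto
      finally show ?thesis using a by simp
    qed
    have "(cvec_norm (?D *\<^sub>v x))\<^sup>2 = (\<Sum>a<n. (\<bar>f a\<bar> * cmod (x $ a))\<^sup>2)"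
      using ent by (simp add: cvec_norm_sq norm_mult mat_diag_def)
    also have "\<dots> \<le> (\<Sum>a<n. (cmod (x $ a))\<^sup>2)"
      using assms by (intro sum_mono power_mono) (auto intro: mult_left_le_one_le)
    also have "\<dots> = (cvec_norm x)\<^sup>2" using x by (simp add: cvec_norm_sq)
    finally show ?thesis by (rule power2_le_imp_le) simp
  qed
  then show ?thesis by (simp add: contraction_mat_def)
qed

lemma index_mat_diag_mult:
  fixes f :: "nat \<Rightarrow> complex"
  assumes "K \<in> carrier_mat n n" "a < n" "b < n"
  shows "(mat_diag n f * K) $$ (a, b) = f a * K $$ (a, b)"
    and "(K * mat_diag n f) $$ (a, b) = K $$ (a, b) * f b"
  using assms by (simp_all add: mat_diag_mult_left [of _ n n] mat_diag_mult_right [of _ n n])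

subsection \<open>Making one matrix commute with all others\<close>

text \<open>With cells of length \<open>sqrt \<epsilon>\<close>, the first summand bounds the
  displacement of the diagonalized matrix and the second that of a pinched one. The sum serves for
  both cases.\<close>

definition step_error :: "nat \<Rightarrow> real \<Rightarrow> real" where
  "step_error k \<epsilon> = sqrt \<epsilon> + sqrt (2 * real k * sqrt \<epsilon>)"

text \<open>The commutator norm controls squared eigenvalue gaps, while the choice of cells needs
  their first powers. The two are linked through the total weight, at most \<open>n\<close> for a
  contraction.\<close>

lemma weighted_offdiagonal_le:
  assumes n: "n \<ge> 1" and eps: "\<epsilon> > 0" and K: "contraction_mat n K"
    and comm: "mat_tr_norm (mat_commutator (mat_diag n (\<lambda>a. complex_of_real (l a))) K) \<le> \<epsilon>"
  shows "(\<Sum>a<n. \<Sum>b<n. \<bar>l a - l b\<bar> * (cmod (K $$ (a, b)))\<^sup>2) \<le> \<epsilon> * real n"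
proof -
  let ?D = "mat_diag n (\<lambda>a. complex_of_real (l a))"
  have Kc: "K \<in> carrier_mat n n" using K by (simp add: contraction_mat_def)
  have Dc: "?D \<in> carrier_mat n n" by simp
  have Cc: "mat_commutator ?D K \<in> carrier_mat n n"
    unfolding mat_commutator_def by (rule minus_carrier_mat [OF mult_carrier_mat [OF Kc Dc]])
  have ent: "(cmod (mat_commutator ?D K $$ (a, b)))\<^sup>2 = (l a - l b)\<^sup>2 * (cmod (K $$ (a, b)))\<^sup>2"
    if "a < n" "b < n" for a b
  proof -
    have "mat_commutator ?D K $$ (a, b) = complex_of_real (l a - l b) * K $$ (a, b)"
      using that Kc carrier_matD [OF Dc] index_mat_diag_mult [OF Kc that, of "\<lambda>a. complex_of_real (l a)"]
      by (simp add: mat_commutator_def algebra_simps)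
    then show ?thesis by (simp add: norm_mult power_mult_distrib del: of_real_diff)
  qed
  have sq: "(\<Sum>a<n. \<Sum>b<n. (l a - l b)\<^sup>2 * (cmod (K $$ (a, b)))\<^sup>2) \<le> real n * \<epsilon>\<^sup>2"
    using comm eps ent by (simp add: mat_tr_norm_le_iff [OF Cc n])
  \<comment> \<open>AM-GM: $d \le (d^2 / \epsilon + \epsilon) / 2$\<close>
  have "(\<Sum>a<n. \<Sum>b<n. \<bar>l a - l b\<bar> * (cmod (K $$ (a, b)))\<^sup>2)
      \<le> (\<Sum>a<n. \<Sum>b<n. ((l a - l b)\<^sup>2 / \<epsilon> + \<epsilon>) / 2 * (cmod (K $$ (a, b)))\<^sup>2)"
  proof (intro sum_mono mult_right_mono)
    fix a b
    have "0 \<le> (\<bar>l a - l b\<bar> - \<epsilon>)\<^sup>2" by simp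
    then show "\<bar>l a - l b\<bar> \<le> ((l a - l b)\<^sup>2 / \<epsilon> + \<epsilon>) / 2"
      using eps by (simp add: field_simps power2_eq_square)
  qed simp
  also have "\<dots> = (\<Sum>a<n. \<Sum>b<n. (l a - l b)\<^sup>2 * (cmod (K $$ (a, b)))\<^sup>2 / (2 * \<epsilon>)
      + \<epsilon> / 2 * (cmod (K $$ (a, b)))\<^sup>2)"
    by (intro sum.cong refl) (simp add: distrib_right add_divide_distrib)
  also have "\<dots> = (\<Sum>a<n. \<Sum>b<n. (l a - l b)\<^sup>2 * (cmod (K $$ (a, b)))\<^sup>2) / (2 * \<epsilon>)
      + \<epsilon> / 2 * (\<Sum>a<n. \<Sum>b<n. (cmod (K $$ (a, b)))\<^sup>2)"
    by (simp only: sum_distrib_left sum_divide_distrib sum.distrib)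
  also have "\<dots> \<le> real n * \<epsilon>\<^sup>2 / (2 * \<epsilon>) + \<epsilon> / 2 * real n"
    using sq contraction_mat_entries_sq [OF K] eps
    by (intro add_mono divide_right_mono mult_left_mono) auto
  also have "\<dots> = \<epsilon> * real n" using eps by (simp add: field_simps power2_eq_square)
  finally show ?thesis .
qed

text \<open>One step in an eigenbasis of \<open>H r\<close>: round its eigenvalues to one value per
  cell and pinch the other matrices. Matrices with index below \<open>r\<close> commute with
  \<open>H r\<close>, hence are already block-diagonal, and so keep their commutation
  relations.\<close>

lemma diagonal_step:
  fixes H :: "nat \<Rightarrow> complex mat" and l :: "nat \<Rightarrow> real"
  assumes n: "n \<ge> 1" and eps: "\<epsilon> > 0" and r: "r \<in> {1..k}"
    and H: "\<And>i. i \<in> {1..k} \<Longrightarrow> hermitian_contraction n (H i)"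
    and Hr: "H r = mat_diag n (\<lambda>a. complex_of_real (l a))"
    and small: "\<And>i. i \<in> {1..k} \<Longrightarrow> mat_tr_norm (mat_commutator (H r) (H i)) \<le> \<epsilon>"
    and comm: "\<And>i j. i \<in> {1..k} \<Longrightarrow> i < r \<Longrightarrow> j \<in> {1..k} \<Longrightarrow> H i * H j = H j * H i"
  shows "\<exists>A. (\<forall>i\<in>{1..k}. hermitian_contraction n (A i) \<and> mat_tr_norm (H i - A i) \<le> step_error k \<epsilon>) \<and>
    (\<forall>i\<in>{1..k}. \<forall>j\<in>{1..k}. i \<le> r \<longrightarrow> A i * A j = A j * A i)"
proof -
  have contr: "contraction_mat n (H i)" and Hc: "H i \<in> carrier_mat n n"
    and Hh: "mat_adjoint (H i) = H i" if "i \<in> {1..k}" for i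
    using H [OF that] by (auto simp: hermitian_contraction_def contraction_mat_def)
  \<comment> \<open>This choice balances the cell length \<eta> against the separated weight, of
    order \<open>\<epsilon> / \<eta>\<close>.\<close>
  define \<eta> where "\<eta> = sqrt \<epsilon>"
  have eta: "\<eta> > 0" "\<epsilon> / \<eta> = \<eta>" using eps by (auto simp: \<eta>_def real_div_sqrt)
  \<comment> \<open>The weights of all \<open>k\<close> matrices are added so that one choice of
    cells serves them all, at the cost of a factor \<open>k\<close>.\<close>
  define w where "w = (\<lambda>a b. \<Sum>i\<in>{1..k}. (cmod (H i $$ (a, b)))\<^sup>2)"
  define M where "M = real k * real n"
  have w0: "w a b \<ge> 0" for a b by (simp add: w_def sum_nonneg)
  have swap: "(\<Sum>a<n. \<Sum>b<n. u a b * w a b)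
      = (\<Sum>i\<in>{1..k}. \<Sum>a<n. \<Sum>b<n. u a b * (cmod (H i $$ (a, b)))\<^sup>2)" for u :: "nat \<Rightarrow> nat \<Rightarrow> real"
  proof -
    have "(\<Sum>i\<in>{1..k}. \<Sum>a<n. \<Sum>b<n. u a b * (cmod (H i $$ (a, b)))\<^sup>2)
        = (\<Sum>a<n. \<Sum>i\<in>{1..k}. \<Sum>b<n. u a b * (cmod (H i $$ (a, b)))\<^sup>2)"
      by (rule sum.swap)
    also have "\<dots> = (\<Sum>a<n. \<Sum>b<n. \<Sum>i\<in>{1..k}. u a b * (cmod (H i $$ (a, b)))\<^sup>2)"
      by (intro sum.cong refl sum.swap)
    finally show ?thesis by (simp add: w_def sum_distrib_left)
  qed
  have "(\<Sum>i\<in>{1..k}. \<Sum>a<n. \<Sum>b<n. \<bar>l a - l b\<bar> * (cmod (H i $$ (a, b)))\<^sup>2)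
      \<le> (\<Sum>i\<in>{1..k}. \<epsilon> * real n)"
    by (intro sum_mono weighted_offdiagonal_le [OF n eps contr small [unfolded Hr]])
  then have near: "(\<Sum>a<n. \<Sum>b<n. \<bar>l a - l b\<bar> * w a b) \<le> \<epsilon> * M"
    unfolding swap by (simp add: M_def mult_ac)
  have "(\<Sum>i\<in>{1..k}. \<Sum>a<n. \<Sum>b<n. (cmod (H i $$ (a, b)))\<^sup>2) \<le> (\<Sum>i\<in>{1..k}. real n)"
    by (intro sum_mono contraction_mat_entries_sq contr)
  then have total: "(\<Sum>a<n. \<Sum>b<n. w a b) \<le> M"
    using swap [of "\<lambda>_ _. 1"] by (simp add: M_def)
  obtain c :: "real \<Rightarrow> int" and g :: "int \<Rightarrow> real" where cg: "\<And>x. \<bar>g (c x) - x\<bar> \<le> \<eta>"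
    and sep: "(\<Sum>a<n. \<Sum>b<n. if c (l a) = c (l b) then 0 else w a b) \<le> 2 * \<epsilon> / \<eta> * M"
    using good_cells_exist [OF w0 eps eta(1) near total] by blast
  define p where "p = (\<lambda>a. c (l a))"
  \<comment> \<open>Clipping to $[-1, 1]$ keeps the operator norm at most 1 and moves no value away from
    the spectrum.\<close>
  define f where "f = (\<lambda>a. max (- 1) (min 1 (g (p a))))"
  define D where "D = mat_diag n (\<lambda>a. complex_of_real (f a))"
  define A where "A = (\<lambda>i. if i = r then D else pinch p (H i))"
  have Dc: "D \<in> carrier_mat n n" by (simp add: D_def)
  have l1: "\<bar>l a\<bar> \<le> 1" if "a < n" for a
    using contraction_mat_entry [OF contr [OF r] that that] that by (simp add: Hr mat_diag_def)
  have fl: "\<bar>l a - f a\<bar> \<le> \<eta>" if "a < n" for a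
    using l1 [OF that] cg [of "l a"] eta(1) by (auto simp: f_def p_def)
  have err_pinch: "mat_tr_norm (H i - pinch p (H i)) \<le> sqrt (2 * real k * sqrt \<epsilon>)"
    if i: "i \<in> {1..k}" for i
  proof -
    have pc: "H i - pinch p (H i) \<in> carrier_mat n n"
      by (rule minus_carrier_mat [OF pinch_carrier [OF Hc [OF i]]])
    have "(\<Sum>a<n. \<Sum>b<n. (cmod ((H i - pinch p (H i)) $$ (a, b)))\<^sup>2)
        \<le> (\<Sum>a<n. \<Sum>b<n. if p a = p b then 0 else w a b)"
    proof (intro sum_mono)
      fix a b assume "a \<in> {..<n}" "b \<in> {..<n}"
      moreover have "(cmod (H i $$ (a, b)))\<^sup>2 \<le> w a b"
        unfolding w_def by (rule member_le_sum [OF i]) auto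
      ultimately show "(cmod ((H i - pinch p (H i)) $$ (a, b)))\<^sup>2 \<le> (if p a = p b then 0 else w a b)"
        using Hc [OF i] by (simp add: index_pinch)
    qed
    also have "\<dots> \<le> 2 * \<epsilon> / \<eta> * M" using sep by (simp add: p_def)
    also have "\<dots> = 2 * (\<epsilon> / \<eta>) * M" by simp
    also have "\<dots> = real n * (sqrt (2 * real k * sqrt \<epsilon>))\<^sup>2"
      unfolding eta(2) using eps by (simp add: M_def \<eta>_def mult_ac)
    finally show ?thesis
      using eps by (subst mat_tr_norm_le_iff [OF pc n]) auto
  qed
  have err_diag: "mat_tr_norm (H r - D) \<le> sqrt \<epsilon>"
  proof -
    have dc: "H r - D \<in> carrier_mat n n" by (rule minus_carrier_mat [OF Dc])
    have "(\<Sum>a<n. \<Sum>b<n. (cmod ((H r - D) $$ (a, b)))\<^sup>2) \<le> (\<Sum>a<n. \<Sum>b<n. if a = b then \<eta>\<^sup>2 else 0)"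
    proof (intro sum_mono)
      fix a b assume ab: "a \<in> {..<n}" "b \<in> {..<n}"
      have "cmod (complex_of_real (l b - f b)) \<le> \<eta>" using fl [of b] ab by (simp del: of_real_diff)
      then have "(cmod (complex_of_real (l b) - complex_of_real (f b)))\<^sup>2 \<le> \<eta>\<^sup>2"
        by (intro power_mono) auto
      then show "(cmod ((H r - D) $$ (a, b)))\<^sup>2 \<le> (if a = b then \<eta>\<^sup>2 else 0)"
        using ab by (auto simp: Hr D_def mat_diag_def)
    qed
    also have "\<dots> = real n * (sqrt \<epsilon>)\<^sup>2" by (simp add: \<eta>_def)
    finally show ?thesis
      using eps by (subst mat_tr_norm_le_iff [OF dc n]) auto
  qed
  \<comment> \<open>\<open>f a\<close> depends on \<open>a\<close> only through its cell, so
    \<open>D\<close> is scalar on every block.\<close>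
  have D_comm: "D * pinch p K = pinch p K * D" if K: "K \<in> carrier_mat n n" for K
  proof (rule eq_matI)
    fix a b assume "a < dim_row (pinch p K * D)" "b < dim_col (pinch p K * D)"
    then have ab: "a < n" "b < n" using K Dc by auto
    show "(D * pinch p K) $$ (a, b) = (pinch p K * D) $$ (a, b)"
      unfolding D_def index_mat_diag_mult [OF pinch_carrier [OF K] ab]
      using ab K by (simp add: index_pinch f_def)
  qed (use K Dc in auto)
  \<comment> \<open>Commuting with the diagonal \<open>H r\<close> forces the entries between
    different eigenvalues to vanish, and equal eigenvalues share a cell.\<close>
  have fixed: "pinch p (H i) = H i" if i: "i \<in> {1..k}" "i < r" for i
  proof (rule eq_matI)
    fix a b assume "a < dim_row (H i)" "b < dim_col (H i)"
    then have ab: "a < n" "b < n" using Hc [OF i(1)] by auto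
    have "(H i * H r) $$ (a, b) = (H r * H i) $$ (a, b)" using comm [OF i r] by simp
    then have "H i $$ (a, b) * (complex_of_real (l b) - complex_of_real (l a)) = 0"
      unfolding Hr index_mat_diag_mult [OF Hc [OF i(1)] ab] by (simp add: algebra_simps)
    then have "H i $$ (a, b) = 0 \<or> l a = l b" by auto
    then show "pinch p (H i) $$ (a, b) = H i $$ (a, b)"
      using ab Hc [OF i(1)] by (auto simp: index_pinch p_def)
  qed auto
  have "hermitian_contraction n (A i) \<and> mat_tr_norm (H i - A i) \<le> step_error k \<epsilon>"
    if i: "i \<in> {1..k}" for i
  proof (cases "i = r")
    case True
    have "mat_adjoint D = D"
      by (rule eq_matI) (auto simp: D_def mat_diag_def index_mat_adjoint)
    moreover have "contraction_mat n D"
      unfolding D_def by (rule contraction_mat_diag) (auto simp: f_def)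
    moreover have "sqrt \<epsilon> \<le> step_error k \<epsilon>" using eps by (simp add: step_error_def)
    ultimately show ?thesis
      using err_diag True by (simp add: A_def hermitian_contraction_def)
  next
    case False
    have "hermitian_contraction n (pinch p (H i))"
      using contraction_mat_pinch [OF contr [OF i]] mat_adjoint_pinch [OF Hc [OF i]] Hh [OF i]
      by (simp add: hermitian_contraction_def)
    moreover have "sqrt (2 * real k * sqrt \<epsilon>) \<le> step_error k \<epsilon>" using eps by (simp add: step_error_def)
    ultimately show ?thesis
      using err_pinch [OF i] False by (simp add: A_def)
  qed
  moreover have "A i * A j = A j * A i" if i: "i \<in> {1..k}" and j: "j \<in> {1..k}" and "i \<le> r" for i j
  proof (cases "i = r \<or> j = r")
    case True
    then show ?thesis
      using D_comm [OF Hc [OF i]] D_comm [OF Hc [OF j]] by (auto simp: A_def)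
  next
    case False
    then have ir: "i < r" using \<open>i \<le> r\<close> by auto
    note fi = fixed [OF i ir]
    \<comment> \<open>Since \<open>H i\<close> is its own pinching, both products are pinchings, of
      \<open>H i * H j\<close> and \<open>H j * H i\<close>, which agree.\<close>
    show ?thesis
      using False comm [OF i ir j] pinch_mult_left [OF Hc [OF i] fi Hc [OF j]]
        pinch_mult_right [OF Hc [OF i] fi Hc [OF j]]
      by (simp add: A_def fi)
  qed
  ultimately show ?thesis by blast
qed

section \<open>Unitary changes of basis\<close>

definition conj_by :: "complex mat \<Rightarrow> complex mat \<Rightarrow> complex mat" where
  "conj_by V X = mat_adjoint V * X * V"

lemma conj_by_carrier:
  "V \<in> carrier_mat n n \<Longrightarrow> X \<in> carrier_mat n n \<Longrightarrow> conj_by V X \<in> carrier_mat n n"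
  by (simp add: conj_by_def mult_carrier_mat [of _ n n _ n])

lemma conj_by_adjoint_cancel:
  assumes V: "unitary_mat n V" and X: "X \<in> carrier_mat n n"
  shows "conj_by (mat_adjoint V) (conj_by V X) = X"
proof -
  have Vc: "V \<in> carrier_mat n n" and VV: "V * mat_adjoint V = 1\<^sub>m n"
    using V by (auto simp: unitary_mat_def)
  have "mat_adjoint (1\<^sub>m n :: complex mat) = 1\<^sub>m n"
    by (rule eq_matI) (auto simp: index_mat_adjoint)
  then show ?thesis
    using conjugation_mult [OF X Vc mat_adjoint_carrier [OF Vc]] X by (simp add: conj_by_def VV)
qed

lemma conj_by_mult:
  assumes V: "unitary_mat n V" and X: "X \<in> carrier_mat n n" and Y: "Y \<in> carrier_mat n n"
  shows "conj_by V X * conj_by V Y = conj_by V (X * Y)"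
proof -
  have Vc: "V \<in> carrier_mat n n" and VV: "V * mat_adjoint V = 1\<^sub>m n"
    using V by (auto simp: unitary_mat_def)
  note simps = assoc_mult_mat [of _ n n _ n _ n] mult_carrier_mat [of _ n n _ n]
    mat_adjoint_carrier [OF Vc]
  have "V * (mat_adjoint V * (Y * V)) = (V * mat_adjoint V) * (Y * V)"
    using Vc Y by (simp add: simps)
  also have "\<dots> = Y * V" using Vc Y by (simp add: VV mult_carrier_mat [of _ n n _ n])
  finally show ?thesis using Vc X Y by (simp add: conj_by_def simps)
qed

lemma conj_by_minus:
  assumes V: "V \<in> carrier_mat n n" and X: "X \<in> carrier_mat n n" and Y: "Y \<in> carrier_mat n n"
  shows "conj_by V X - conj_by V Y = conj_by V (X - Y)"
proof -
  have "mat_adjoint V * (X - Y) = mat_adjoint V * X - mat_adjoint V * Y"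
    by (rule mult_minus_distrib_mat [OF mat_adjoint_carrier [OF V] X Y])
  then show ?thesis
    unfolding conj_by_def using V X Y
    by (simp add: minus_mult_distrib_mat [of _ n n _ _ n] mult_carrier_mat [of _ n n _ n])
qed

lemma mat_tr_norm_conj_by_le:
  assumes V: "unitary_mat n V" and X: "X \<in> carrier_mat n n"
  shows "mat_tr_norm (conj_by V X) \<le> mat_tr_norm X"
proof -
  have Vc: "V \<in> carrier_mat n n" using V by (simp add: unitary_mat_def)
  note Va = unitary_mat_contraction [OF unitary_mat_adjoint [OF V]]
  have "mat_tr_norm (conj_by V X) \<le> mat_tr_norm (mat_adjoint V * X)"
    unfolding conj_by_def
    by (rule mat_tr_norm_contraction_right [OF Va mult_carrier_mat [OF mat_adjoint_carrier [OF Vc] X]])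
  also have "\<dots> \<le> mat_tr_norm X"
    by (rule mat_tr_norm_contraction_left [OF Va X])
  finally show ?thesis .
qed

lemma hermitian_contraction_conj_by:
  assumes V: "unitary_mat n V" and X: "hermitian_contraction n X"
  shows "hermitian_contraction n (conj_by V X)"
proof -
  have Vc: "V \<in> carrier_mat n n" using V by (simp add: unitary_mat_def)
  show ?thesis
    using mat_adjoint_conjugation [OF hermitian_contraction_carrier [OF X] Vc] X
      unitary_mat_contraction [OF V] unitary_mat_contraction [OF unitary_mat_adjoint [OF V]]
    by (auto simp: hermitian_contraction_def conj_by_def intro!: contraction_mat_mult)
qed

text \<open>Passes to an eigenbasis of \<open>H r\<close>, applies \<open>diagonal_step\<close>
  there and conjugates back. Conjugation respects products and Hermitian contractions and does not
  increase the trace norm.\<close>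

lemma commuting_step:
  fixes H :: "nat \<Rightarrow> complex mat"
  assumes n: "n \<ge> 1" and eps: "\<epsilon> > 0" and r: "r \<in> {1..k}"
    and H: "\<And>i. i \<in> {1..k} \<Longrightarrow> hermitian_contraction n (H i)"
    and small: "\<And>i j. i \<in> {1..k} \<Longrightarrow> j \<in> {1..k} \<Longrightarrow> mat_tr_norm (mat_commutator (H i) (H j)) \<le> \<epsilon>"
    and comm: "\<And>i j. i \<in> {1..k} \<Longrightarrow> i < r \<Longrightarrow> j \<in> {1..k} \<Longrightarrow> H i * H j = H j * H i"
  shows "\<exists>A. (\<forall>i\<in>{1..k}. hermitian_contraction n (A i) \<and> mat_tr_norm (H i - A i) \<le> step_error k \<epsilon>) \<and>
    (\<forall>i\<in>{1..k}. \<forall>j\<in>{1..k}. i \<le> r \<longrightarrow> A i * A j = A j * A i)"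
proof -
  note Hc = H [THEN hermitian_contraction_carrier]
  have "mat_adjoint (H r) = H r" using H [OF r] by (simp add: hermitian_contraction_def)
  from hermitian_spectral [OF Hc [OF r] this] obtain U l where U: "unitary_mat n U"
    and diag: "conj_by U (H r) = mat_diag n (\<lambda>a. complex_of_real (l a))"
    unfolding conj_by_def by blast
  have Uc: "U \<in> carrier_mat n n" using U by (simp add: unitary_mat_def)
  note U' = unitary_mat_adjoint [OF U]
  have small': "mat_tr_norm (mat_commutator (conj_by U (H r)) (conj_by U (H i))) \<le> \<epsilon>" if i: "i \<in> {1..k}" for i
  proof -
    have c: "H r * H i \<in> carrier_mat n n" "H i * H r \<in> carrier_mat n n"
      using Hc [OF r] Hc [OF i] by auto
    have "mat_commutator (conj_by U (H r)) (conj_by U (H i)) = conj_by U (mat_commutator (H r) (H i))"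
      unfolding mat_commutator_def conj_by_mult [OF U Hc [OF r] Hc [OF i]]
        conj_by_mult [OF U Hc [OF i] Hc [OF r]] by (rule conj_by_minus [OF Uc c])
    also have "mat_tr_norm \<dots> \<le> mat_tr_norm (mat_commutator (H r) (H i))"
      unfolding mat_commutator_def by (rule mat_tr_norm_conj_by_le [OF U minus_carrier_mat [OF c(2)]])
    also have "\<dots> \<le> \<epsilon>" by (rule small [OF r i])
    finally show ?thesis .
  qed
  have comm': "conj_by U (H i) * conj_by U (H j) = conj_by U (H j) * conj_by U (H i)"
    if "i \<in> {1..k}" "i < r" "j \<in> {1..k}" for i j
    using comm [OF that] that by (simp add: conj_by_mult [OF U Hc Hc])
  obtain B where B: "\<And>i. i \<in> {1..k} \<Longrightarrow> hermitian_contraction n (B i)"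
    and err: "\<And>i. i \<in> {1..k} \<Longrightarrow> mat_tr_norm (conj_by U (H i) - B i) \<le> step_error k \<epsilon>"
    and Bcomm: "\<And>i j. i \<in> {1..k} \<Longrightarrow> j \<in> {1..k} \<Longrightarrow> i \<le> r \<Longrightarrow> B i * B j = B j * B i"
    using diagonal_step [where H = "\<lambda>i. conj_by U (H i)",
        OF n eps r hermitian_contraction_conj_by [OF U H] diag small' comm'] by blast
  note Bc = B [THEN hermitian_contraction_carrier]
  define A where "A = (\<lambda>i. conj_by (mat_adjoint U) (B i))"
  have "mat_tr_norm (H i - A i) \<le> step_error k \<epsilon>" if i: "i \<in> {1..k}" for i
  proof -
    have "H i - A i = conj_by (mat_adjoint U) (conj_by U (H i)) - A i"
      by (simp add: conj_by_adjoint_cancel [OF U Hc [OF i]])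
    also have "\<dots> = conj_by (mat_adjoint U) (conj_by U (H i) - B i)"
      unfolding A_def
      by (rule conj_by_minus [OF mat_adjoint_carrier [OF Uc] conj_by_carrier [OF Uc Hc [OF i]] Bc [OF i]])
    also have "mat_tr_norm \<dots> \<le> mat_tr_norm (conj_by U (H i) - B i)"
      by (rule mat_tr_norm_conj_by_le [OF U' minus_carrier_mat [OF Bc [OF i]]])
    finally show ?thesis using err [OF i] by linarith
  qed
  moreover have "hermitian_contraction n (A i)" if "i \<in> {1..k}" for i
    unfolding A_def by (rule hermitian_contraction_conj_by [OF U' B [OF that]])
  moreover have "A i * A j = A j * A i" if "i \<in> {1..k}" "j \<in> {1..k}" "i \<le> r" for i j
    using Bcomm [OF that] that unfolding A_def by (simp add: conj_by_mult [OF U' Bc Bc])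
  ultimately show ?thesis by blast
qed

subsection \<open>Iteration\<close>

text \<open>A bound on the commutators after \<open>r\<close> steps. The 4 is 2 + 2: both arguments
  of a commutator move by at most \<open>step_error\<close>, and each displacement counts
  twice.\<close>

primrec iterated_defect :: "nat \<Rightarrow> nat \<Rightarrow> real \<Rightarrow> real" where
  "iterated_defect k 0 \<epsilon> = \<epsilon>"
| "iterated_defect k (Suc r) \<epsilon> = iterated_defect k r \<epsilon> + 4 * step_error k (iterated_defect k r \<epsilon>)"

definition total_error :: "nat \<Rightarrow> nat \<Rightarrow> real \<Rightarrow> real" where
  "total_error k r \<epsilon> = (\<Sum>s<r. step_error k (iterated_defect k s \<epsilon>))"

lemma step_error_nonneg: "\<epsilon> \<ge> 0 \<Longrightarrow> step_error k \<epsilon> \<ge> 0"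
  by (simp add: step_error_def)

text \<open>Every step takes cells whose length is the root of the current defect, so the defect
  must stay strictly positive.\<close>

lemma iterated_defect_pos: "\<epsilon> > 0 \<Longrightarrow> iterated_defect k r \<epsilon> > 0"
  by (induction r) (auto intro!: add_pos_nonneg step_error_nonneg)

lemma tendsto_step_error:
  assumes "(f \<longlongrightarrow> 0) F"
  shows "((\<lambda>x. step_error k (f x)) \<longlongrightarrow> 0) F"
proof -
  have "((\<lambda>x. step_error k (f x)) \<longlongrightarrow> sqrt 0 + sqrt (2 * real k * sqrt 0)) F"
    unfolding step_error_def by (intro tendsto_intros assms)
  then show ?thesis by simp
qed

lemma tendsto_iterated_defect: "((\<lambda>\<epsilon>. iterated_defect k r \<epsilon>) \<longlongrightarrow> 0) (at_right 0)"
proof (induction r)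
  case 0
  show ?case by simp
next
  case (Suc r)
  have "((\<lambda>\<epsilon>. iterated_defect k r \<epsilon> + 4 * step_error k (iterated_defect k r \<epsilon>)) \<longlongrightarrow> 0 + 4 * 0) (at_right 0)"
    by (intro tendsto_intros Suc tendsto_step_error)
  then show ?case by simp
qed

lemma tendsto_total_error: "((\<lambda>\<epsilon>. total_error k r \<epsilon>) \<longlongrightarrow> 0) (at_right 0)"
  unfolding total_error_def
  by (intro tendsto_null_sum tendsto_step_error tendsto_iterated_defect)

text \<open>The invariant after \<open>r\<close> steps: the first \<open>r\<close> matrices commute
  with all others exactly, while the rest still almost commute, with a larger defect from which the
  next step starts.\<close>

lemma iterated_commuting_steps:
  fixes H :: "nat \<Rightarrow> complex mat"
  assumes n: "n \<ge> 1" and eps: "\<epsilon> > 0"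
    and H: "\<And>i. i \<in> {1..k} \<Longrightarrow> hermitian_contraction n (H i)"
    and small: "\<And>i j. i \<in> {1..k} \<Longrightarrow> j \<in> {1..k} \<Longrightarrow> mat_tr_norm (mat_commutator (H i) (H j)) \<le> \<epsilon>"
    and r: "r \<le> k"
  shows "\<exists>A. (\<forall>i\<in>{1..k}. hermitian_contraction n (A i) \<and> mat_tr_norm (H i - A i) \<le> total_error k r \<epsilon>) \<and>
    (\<forall>i\<in>{1..k}. \<forall>j\<in>{1..k}. mat_tr_norm (mat_commutator (A i) (A j)) \<le> iterated_defect k r \<epsilon>) \<and>
    (\<forall>i\<in>{1..k}. \<forall>j\<in>{1..k}. i \<le> r \<longrightarrow> A i * A j = A j * A i)"
  using r
proof (induction r)
  case 0
  have "mat_tr_norm (H i - H i) = 0" for i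
    by (simp add: mat_tr_norm_def)
  then show ?case
    using H small by (intro exI [of _ H]) (auto simp: total_error_def)
next
  case (Suc r)
  from Suc.IH [OF Suc_leD [OF Suc.prems]] obtain B where B: "\<And>i. i \<in> {1..k} \<Longrightarrow> hermitian_contraction n (B i)"
    and errB: "\<And>i. i \<in> {1..k} \<Longrightarrow> mat_tr_norm (H i - B i) \<le> total_error k r \<epsilon>"
    and smallB: "\<And>i j. i \<in> {1..k} \<Longrightarrow> j \<in> {1..k} \<Longrightarrow>
      mat_tr_norm (mat_commutator (B i) (B j)) \<le> iterated_defect k r \<epsilon>"
    and commB: "\<And>i j. i \<in> {1..k} \<Longrightarrow> j \<in> {1..k} \<Longrightarrow> i \<le> r \<Longrightarrow> B i * B j = B j * B i"
    by blast
  have comm: "B i * B j = B j * B i" if "i \<in> {1..k}" "i < Suc r" "j \<in> {1..k}" for i j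
    by (rule commB [OF that(1,3)]) (use that(2) in simp)
  have r: "Suc r \<in> {1..k}" using Suc.prems by simp
  let ?e = "step_error k (iterated_defect k r \<epsilon>)"
  obtain A where A: "\<And>i. i \<in> {1..k} \<Longrightarrow> hermitian_contraction n (A i)"
    and errA: "\<And>i. i \<in> {1..k} \<Longrightarrow> mat_tr_norm (B i - A i) \<le> ?e"
    and commA: "\<And>i j. i \<in> {1..k} \<Longrightarrow> j \<in> {1..k} \<Longrightarrow> i \<le> Suc r \<Longrightarrow> A i * A j = A j * A i"
    using commuting_step [where H = B, OF n iterated_defect_pos [OF eps] r B smallB comm] by blast
  have "mat_tr_norm (H i - A i) \<le> total_error k (Suc r) \<epsilon>" if i: "i \<in> {1..k}" for i
    using errA [OF i] errB [OF i]
      mat_tr_norm_triangle [OF hermitian_contraction_carrier [OF H [OF i]]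
        hermitian_contraction_carrier [OF B [OF i]] hermitian_contraction_carrier [OF A [OF i]]]
    by (simp add: total_error_def)
  moreover have "mat_tr_norm (mat_commutator (A i) (A j)) \<le> iterated_defect k (Suc r) \<epsilon>"
    if i: "i \<in> {1..k}" and j: "j \<in> {1..k}" for i j
    using mat_tr_norm_commutator_perturb [OF B [OF i] B [OF j] A [OF i] A [OF j]]
      smallB [OF i j] errA [OF i] errA [OF j] by simp
  ultimately show ?case using A commA by blast
qed

theorem theorem4:
  shows "\<exists>\<delta> :: real \<Rightarrow> nat \<Rightarrow> real.
    (\<forall>\<epsilon> > 0. \<forall>k. \<delta> \<epsilon> k > 0) \<and>
    (\<forall>k. ((\<lambda>\<epsilon>. \<delta> \<epsilon> k) \<longlongrightarrow> 0) (at_right 0)) \<and>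
    (\<forall>(k :: nat) (n :: nat) (\<epsilon> :: real) (H :: nat \<Rightarrow> complex mat).
      k \<ge> 1 \<longrightarrow> n \<ge> 1 \<longrightarrow> \<epsilon> > 0 \<longrightarrow>
      (\<forall>i\<in>{1..k}. H i \<in> carrier_mat n n \<and> mat_adjoint (H i) = H i \<and> mat_op_norm (H i) \<le> 1) \<longrightarrow>
      (\<forall>i\<in>{1..k}. \<forall>j\<in>{1..k}. mat_tr_norm (mat_commutator (H i) (H j)) \<le> \<epsilon>) \<longrightarrow>
      (\<exists>A :: nat \<Rightarrow> complex mat.
        (\<forall>j\<in>{1..k}. A j \<in> carrier_mat n n \<and> mat_adjoint (A j) = A j) \<and>
        (\<forall>i\<in>{1..k}. \<forall>j\<in>{1..k}. mat_commutator (A i) (A j) = 0\<^sub>m n n) \<and>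
        (\<forall>j\<in>{1..k}. mat_tr_norm (H j - A j) \<le> \<delta> \<epsilon> k \<and> mat_op_norm (A j) \<le> 1)))"
proof (rule exI [of _ "\<lambda>\<epsilon> k. \<epsilon> + total_error k k \<epsilon>"], intro conjI allI impI)
  \<comment> \<open>The summand $\epsilon$ only ensures positivity at $k = 0$.\<close>
  let ?\<delta> = "\<lambda>\<epsilon> k. \<epsilon> + total_error k k \<epsilon>"
  fix k :: nat
  have "total_error k k \<epsilon> \<ge> 0" if "\<epsilon> > 0" for \<epsilon>
    unfolding total_error_def
    by (intro sum_nonneg step_error_nonneg less_imp_le iterated_defect_pos [OF that])
  then show "?\<delta> \<epsilon> k > 0" if "\<epsilon> > 0" for \<epsilon>
    using that by (simp add: add_pos_nonneg)
  show "((\<lambda>\<epsilon>. ?\<delta> \<epsilon> k) \<longlongrightarrow> 0) (at_right 0)"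
    by (intro tendsto_add_zero tendsto_total_error tendsto_ident_at)
  fix n :: nat and \<epsilon> :: real and H :: "nat \<Rightarrow> complex mat"
  assume "k \<ge> 1" and n: "n \<ge> 1" and eps: "\<epsilon> > 0"
    and H: "\<forall>i\<in>{1..k}. H i \<in> carrier_mat n n \<and> mat_adjoint (H i) = H i \<and> mat_op_norm (H i) \<le> 1"
    and small: "\<forall>i\<in>{1..k}. \<forall>j\<in>{1..k}. mat_tr_norm (mat_commutator (H i) (H j)) \<le> \<epsilon>"
  have "hermitian_contraction n (H i)" if "i \<in> {1..k}" for i
    using H that contraction_mat_iff_op_norm [OF _ n] by (auto simp: hermitian_contraction_def)
  \<comment> \<open>After \<open>k\<close> steps the restriction \<open>i \<le> r\<close> covers
    every index. The resulting error does not involve \<open>n\<close>.\<close>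
  from iterated_commuting_steps [where H = H and k = k, OF n eps this small [rule_format] order_refl]
  obtain A where A: "\<And>i. i \<in> {1..k} \<Longrightarrow> hermitian_contraction n (A i)"
    and err: "\<And>i. i \<in> {1..k} \<Longrightarrow> mat_tr_norm (H i - A i) \<le> total_error k k \<epsilon>"
    and comm: "\<And>i j. i \<in> {1..k} \<Longrightarrow> j \<in> {1..k} \<Longrightarrow> A i * A j = A j * A i"
    by (metis atLeastAtMost_iff)
  have Ac: "A i \<in> carrier_mat n n" if "i \<in> {1..k}" for i
    using A [OF that] by (rule hermitian_contraction_carrier)
  have "mat_commutator (A i) (A j) = 0\<^sub>m n n" if "i \<in> {1..k}" "j \<in> {1..k}" for i j
    unfolding mat_commutator_def comm [OF that]
    by (rule minus_r_inv_mat [OF mult_carrier_mat [OF Ac [OF that(2)] Ac [OF that(1)]]])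
  moreover have "mat_op_norm (A i) \<le> 1 \<and> mat_adjoint (A i) = A i" if "i \<in> {1..k}" for i
    using A [OF that] contraction_mat_iff_op_norm [OF Ac [OF that] n]
    by (simp add: hermitian_contraction_def)
  moreover have "mat_tr_norm (H i - A i) \<le> ?\<delta> \<epsilon> k" if "i \<in> {1..k}" for i
    using err [OF that] eps by linarith
  ultimately show "\<exists>A :: nat \<Rightarrow> complex mat.
        (\<forall>j\<in>{1..k}. A j \<in> carrier_mat n n \<and> mat_adjoint (A j) = A j) \<and>
        (\<forall>i\<in>{1..k}. \<forall>j\<in>{1..k}. mat_commutator (A i) (A j) = 0\<^sub>m n n) \<and>
        (\<forall>j\<in>{1..k}. mat_tr_norm (H j - A j) \<le> ?\<delta> \<epsilon> k \<and> mat_op_norm (A j) \<le> 1)"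
    using Ac by blast
qed

end
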